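(* Let $r$ and $k$ be integers with $k\ge r+1\ge 3$, and let $F$ be a graph with chromatic number $k$. Then $$\mathrm{spex}_{r}^{\mathrm{lin}}(n,F^{r})=n\left(\frac{1}{r-1}\left(1-\frac{1}{k-1}\right)+o(1)\right)\quad (n\to\infty).$$
   Context: An $r$-uniform hypergraph is linear if any two distinct edges share at most one vertex; it is $F^r$-free if it has no (not necessarily induced) subhypergraph isomorphic to $F^r$. The $r$-expansion $F^r$ of $F$ is obtained by adding to each edge $e$ of $F$ a set $S_e$ of $r-2$ new vertices (pairwise disjoint and disjoint from $V(F)$), with edges $e\cup S_e$. $\mathrm{spex}_r^{\mathrm{lin}}(n,F^r)$ is the maximum spectral radius $\rho(H)$ over all $F^r$-free linear $r$-uniform hypergraphs $H$ on $n$ vertices, where $\rho(H)$ is the maximum modulus of eigenvalues of the adjacency tensor $\mathcal{A}(H)$ (entry $\frac{1}{(r-1)!}$ at $(i_1,\dots,i_r)$ if $\{v_{i_1},\dots,v_{i_r}\}\in E(H)$, else $0$; $\lambda$ is an eigenvalue if $\sum_{i_2,\dots,i_r}a_{ii_2\cdots i_r}x_{i_2}\cdots x_{i_r}=\lambda x_i^{r-1}$ for all $i$ for some $x\ne 0$). *)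

theory Defs
  imports "HOL-Analysis.Analysis"
begin

text \<open>Graphs: a vertex set V and a set E of 2-element subsets of V.
  Chromatic number: least number of colours of a proper colouring.\<close>
definition chromatic_number :: "'a set \<Rightarrow> 'a set set \<Rightarrow> nat" where
  "chromatic_number V E =
     (LEAST k. \<exists>c::'a \<Rightarrow> nat. c ` V \<subseteq> {..<k} \<and>
                  (\<forall>e\<in>E. \<forall>u\<in>e. \<forall>v\<in>e. u \<noteq> v \<longrightarrow> c u \<noteq> c v))"

definition expansion_vertices :: "nat \<Rightarrow> 'a set \<Rightarrow> 'a set set \<Rightarrow> ('a + ('a set \<times> nat)) set" where
  "expansion_vertices r V E = Inl ` V \<union> {Inr (e, i) | e i. e \<in> E \<and> i < r - 2}"

definition expansion_edges :: "nat \<Rightarrow> 'a set set \<Rightarrow> ('a + ('a set \<times> nat)) set set" where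
  "expansion_edges r E = {Inl ` e \<union> {Inr (e, i) | i. i < r - 2} | e. e \<in> E}"

definition contains_copy :: "'b set \<Rightarrow> 'b set set \<Rightarrow> 'c set \<Rightarrow> 'c set set \<Rightarrow> bool" where
  "contains_copy VH EH VF EF \<longleftrightarrow>
     (\<exists>\<phi>. inj_on \<phi> VF \<and> \<phi> ` VF \<subseteq> VH \<and> (\<forall>e\<in>EF. \<phi> ` e \<in> EH))"

definition linear_uniform_hg :: "nat \<Rightarrow> nat \<Rightarrow> nat set set \<Rightarrow> bool" where
  "linear_uniform_hg r n EH \<longleftrightarrow>
     (\<forall>e\<in>EH. e \<subseteq> {..<n} \<and> card e = r) \<and>
     (\<forall>e\<in>EH. \<forall>f\<in>EH. e \<noteq> f \<longrightarrow> card (e \<inter> f) \<le> 1)"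

text \<open>Adjacency tensor entry a_{i t_0 ... t_{r-2}}.\<close>
definition adj_tensor :: "nat \<Rightarrow> nat set set \<Rightarrow> nat \<Rightarrow> (nat \<Rightarrow> nat) \<Rightarrow> complex" where
  "adj_tensor r EH i t =
     (if insert i (t ` {..<r - 1}) \<in> EH then 1 / of_nat (fact (r - 1)) else 0)"

definition hg_eigenvalue :: "nat \<Rightarrow> nat \<Rightarrow> nat set set \<Rightarrow> complex \<Rightarrow> bool" where
  "hg_eigenvalue r n EH lam \<longleftrightarrow>
     (\<exists>x::nat \<Rightarrow> complex. (\<exists>i<n. x i \<noteq> 0) \<and>
        (\<forall>i<n. (\<Sum>t\<in>{..<r - 1} \<rightarrow>\<^sub>E {..<n}. adj_tensor r EH i t * (\<Prod>m<r - 1. x (t m)))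
               = lam * x i ^ (r - 1)))"

definition hg_spectral_radius :: "nat \<Rightarrow> nat \<Rightarrow> nat set set \<Rightarrow> real" where
  "hg_spectral_radius r n EH = Sup (cmod ` {lam. hg_eigenvalue r n EH lam})"

definition spex_lin :: "nat \<Rightarrow> nat \<Rightarrow> 'a set \<Rightarrow> 'a set set \<Rightarrow> real" where
  "spex_lin r n V E = Sup (hg_spectral_radius r n `
      {EH. linear_uniform_hg r n EH \<and>
           \<not> contains_copy {..<n} EH (expansion_vertices r V E) (expansion_edges r E)})"

end

theory Submission
  imports Defs "HOL-Number_Theory.Cong"
begin

text \<open>
  Upper bound: if \<open>x\<close> is an eigenvector for \<open>\<lambda>\<close>, then AM-GM applied edgewise shows that
  \<open>y\<^sub>i = \<bar>x\<^sub>i\<bar>\<^bsup>r-1\<^esup>\<close> satisfies \<open>(r-1)\<bar>\<lambda>\<bar> y \<le> A y\<close>, where \<open>A\<close> is the adjacency matrix of the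
  2-shadow. Normalising \<open>y\<close> gives a probability measure on the vertices without heavy atoms
  for which the shadow has edge density at least \<open>(r-1)\<bar>\<lambda>\<bar>/n\<close>. If this exceeds \<open>1 - 1/(k-1) + \<epsilon>\<close>, a
  weighted Moon-Moser inequality yields a positive density of \<open>k\<close>-cliques, and hence (Erdos) a
  complete \<open>k\<close>-partite graph with large parts in the shadow. Linearity of the hypergraph then allows
  a greedy embedding of \<open>F\<^sup>r\<close>.

  Lower bound: a hypergraph whose edges are transversal to a partition of the vertices into
  \<open>q = k-1\<close> parts is \<open>F\<^sup>r\<close>-free. An explicit algebraic construction over the integers modulo \<open>m\<close>, with
  \<open>m\<close> coprime to \<open>q!\<close>, gives regular linear hypergraphs of this kind that cover all but a vanishing
  proportion of the pairs between different parts; the degree is an eigenvalue.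
\<close>

section \<open>Averages over weighted lists\<close>

text \<open>An eigenvector need not be close to constant, so the density of the shadow is controlled
  only for the measure that the eigenvector defines. Cliques are therefore counted with weights, and
  Perron-Frobenius theory for tensors is avoided. The obstacle in the embedding is that linearity
  forces the edge through two given vertices: the \<open>r - 2\<close> expansion vertices cannot be
  chosen, so all collisions have to be avoided through the choice of the core vertices alone. In the
  lower bound, a vertex of degree \<open>d\<close> has \<open>(r - 1) * d\<close> shadow neighbours,
  and with \<open>q\<close> equal parts only \<open>(1 - 1/q) * n\<close> vertices are available;
  this is the origin of the constant. The condition \<open>k \<ge> r + 1\<close> gives
  \<open>q \<ge> r\<close>, so that transversal edges exist. For \<open>q > r\<close> an edge misses
  some parts, and each pair of parts is shared by the \<open>N = (q - 2) choose (r - 2)\<close> sets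
  of \<open>r\<close> parts that contain it. The residues modulo \<open>m\<close> are cut into
  \<open>N\<close> intervals of length \<open>w\<close>, about \<open>m / N\<close>, one for each
  such set.\<close>

fun avg :: "'a set \<Rightarrow> ('a \<Rightarrow> real) \<Rightarrow> nat \<Rightarrow> ('a list \<Rightarrow> real) \<Rightarrow> real" where
  "avg U w 0 f = f []"
| "avg U w (Suc k) f = (\<Sum>x\<in>U. w x * avg U w k (\<lambda>xs. f (x # xs)))"

text \<open>A probability measure on \<open>U\<close>; \<open>avg U w k\<close> is then the
  expectation over \<open>k\<close> independent draws. Repeated draws are allowed and are dealt with
  only in \<open>avg_not_distinct_le\<close>.\<close>

locale weighting =
  fixes U :: "'a set" and w :: "'a \<Rightarrow> real"
  assumes fin [simp]: "finite U"
    and nonneg: "\<And>x. x \<in> U \<Longrightarrow> 0 \<le> w x"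
    and total: "(\<Sum>x\<in>U. w x) = 1"
begin

abbreviation E where "E \<equiv> avg U w"

lemma avg_add: "E k (\<lambda>xs. f xs + g xs) = E k f + E k g"
  by (induction k arbitrary: f g) (simp_all add: sum.distrib distrib_left)

lemma avg_cmult: "E k (\<lambda>xs. c * f xs) = c * E k f"
  by (induction k arbitrary: f) (simp_all add: sum_distrib_left mult.left_commute)

lemma avg_const: "E k (\<lambda>_. c) = c"
  by (induction k) (simp_all flip: sum_distrib_right add: total)

lemma avg_sum: "finite I \<Longrightarrow> E k (\<lambda>xs. \<Sum>i\<in>I. f i xs) = (\<Sum>i\<in>I. E k (f i))"
  by (induction I rule: finite_induct) (simp_all add: avg_const avg_add)

lemma avg_mono:
  "(\<And>xs. length xs = k \<Longrightarrow> set xs \<subseteq> U \<Longrightarrow> f xs \<le> g xs) \<Longrightarrow> E k f \<le> E k g"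
proof (induction k arbitrary: f g)
  case (Suc k)
  show ?case
    unfolding avg.simps by (intro sum_mono mult_left_mono Suc.IH Suc.prems) (auto simp: nonneg)
qed auto

lemma avg_cong:
  "(\<And>xs. length xs = k \<Longrightarrow> set xs \<subseteq> U \<Longrightarrow> f xs = g xs) \<Longrightarrow> E k f = E k g"
  by (intro antisym avg_mono) auto

lemma avg_swap: "E k (\<lambda>xs. E l (\<lambda>ys. f xs ys)) = E l (\<lambda>ys. E k (\<lambda>xs. f xs ys))"
  by (induction k arbitrary: f) (simp_all add: avg_sum avg_cmult)

text \<open>The draws are exchangeable, so the entry at any position may be drawn first.
  \<open>moon_moser\<close> uses this to isolate the entry that it deletes.\<close>

lemma avg_insert_nth:
  "i \<le> k \<Longrightarrow> E (Suc k) f = (\<Sum>x\<in>U. w x * E k (\<lambda>ys. f (take i ys @ x # drop i ys)))"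
proof (induction k arbitrary: i f)
  case (Suc k)
  show ?case
  proof (cases i)
    case (Suc j)
    then have j: "j \<le> k" using Suc.prems by simp
    have "E (Suc (Suc k)) f
        = (\<Sum>y\<in>U. w y * (\<Sum>x\<in>U. w x * E k (\<lambda>ys. f (y # take j ys @ x # drop j ys))))"
      by (subst avg.simps(2), subst Suc.IH[OF j]) simp
    also have "\<dots> = (\<Sum>x\<in>U. w x * (\<Sum>y\<in>U. w y * E k (\<lambda>ys. f (y # take j ys @ x # drop j ys))))"
      unfolding sum_distrib_left by (subst sum.swap) (simp add: mult.left_commute)
    finally show ?thesis using Suc by simp
  qed simp
qed simp

lemma avg_nonneg:
  "(\<And>xs. length xs = k \<Longrightarrow> set xs \<subseteq> U \<Longrightarrow> 0 \<le> f xs) \<Longrightarrow> 0 \<le> E k f"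
  using avg_mono[of k "\<lambda>_. 0" f] by (simp add: avg_const)

text \<open>Jensen's inequality for a power: average the tangent line at the mean, which Bernoulli's
  inequality places below the curve. Mean 0 is separate because the tangent is scaled by the inverse
  of the mean.\<close>

lemma avg_power:
  assumes "\<And>xs. 0 \<le> f xs"
  shows "(E k f) ^ t \<le> E k (\<lambda>xs. f xs ^ t)"
proof (cases "E k f = 0")
  case True
  have "0 \<le> E k (\<lambda>xs. f xs ^ t)" by (rule avg_nonneg) (simp add: assms)
  then show ?thesis using True by (cases t) (auto simp: avg_const)
next
  case False
  define a where "a = E k f"
  have a: "a > 0" using False avg_nonneg[of k f] assms a_def by fastforce
  have *: "a ^ t * (1 - real t) + a ^ t * real t / a * f xs \<le> f xs ^ t" for xs
  proof -
    have "-1 \<le> f xs / a - 1" using assms a by simp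
    from Bernoulli_inequality[OF this, of t]
    have "1 + real t * (f xs / a - 1) \<le> (f xs / a) ^ t" by simp
    from mult_left_mono[OF this, of "a ^ t"] a
    show ?thesis by (simp add: power_divide algebra_simps)
  qed
  have "E k (\<lambda>xs. a ^ t * (1 - real t) + a ^ t * real t / a * f xs) \<le> E k (\<lambda>xs. f xs ^ t)"
    by (rule avg_mono) (rule *)
  then show ?thesis
    using a by (simp only: avg_add avg_const avg_cmult a_def[symmetric]) (simp add: algebra_simps)
qed

lemma avg_of_bool_all:
  "E t (\<lambda>ts. of_bool (\<forall>x\<in>set ts. Q x)) = (\<Sum>x\<in>U. w x * of_bool (Q x)) ^ t"
proof (induction t)
  case (Suc t)
  have "E (Suc t) (\<lambda>ts. of_bool (\<forall>x\<in>set ts. Q x))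
      = (\<Sum>x\<in>U. w x * (of_bool (Q x) * E t (\<lambda>ts. of_bool (\<forall>x\<in>set ts. Q x))))"
    by (simp flip: avg_cmult) (simp add: of_bool_conj)
  then show ?case unfolding Suc power_Suc sum_distrib_right by (simp add: mult.assoc)
qed simp

lemma avg_mem_le:
  assumes "\<And>x. x \<in> U \<Longrightarrow> w x \<le> \<eta>" "y \<in> U"
  shows "E t (\<lambda>ts. of_bool (y \<in> set ts)) \<le> real t * \<eta>"
proof (induction t)
  case (Suc t)
  have "E (Suc t) (\<lambda>ts. of_bool (y \<in> set ts))
     \<le> (\<Sum>x\<in>U. w x * E t (\<lambda>ts. of_bool (x = y) + of_bool (y \<in> set ts)))"
    unfolding avg.simps by (intro sum_mono mult_left_mono avg_mono) (auto simp: nonneg)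
  also have "\<dots> = (\<Sum>x\<in>U. w x * of_bool (x = y)) + E t (\<lambda>ts. of_bool (y \<in> set ts))"
    by (simp add: avg_add avg_const distrib_left sum.distrib total flip: sum_distrib_right)
  also have "(\<Sum>x\<in>U. w x * of_bool (x = y)) = w y"
    using assms(2) by (simp add: of_bool_def if_distrib cong: if_cong)
  finally show ?case using Suc assms by (fastforce simp: algebra_simps)
qed simp

text \<open>The birthday bound. With small atoms, \<open>t\<close> draws are mostly distinct and so
  form a set of \<open>t\<close> elements.\<close>

lemma avg_not_distinct_le:
  assumes "\<And>x. x \<in> U \<Longrightarrow> w x \<le> \<eta>"
  shows "E t (\<lambda>ts. of_bool (\<not> distinct ts)) \<le> (real t)\<^sup>2 * \<eta>"
proof (induction t)
  case (Suc t)
  have "U \<noteq> {}" using total by auto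
  then have eta: "0 \<le> \<eta>" using assms nonneg by (meson all_not_in_conv order_trans)
  have "E (Suc t) (\<lambda>ts. of_bool (\<not> distinct ts))
     \<le> (\<Sum>x\<in>U. w x * E t (\<lambda>ts. of_bool (x \<in> set ts) + of_bool (\<not> distinct ts)))"
    unfolding avg.simps by (intro sum_mono mult_left_mono avg_mono) (auto simp: nonneg)
  also have "\<dots> \<le> (\<Sum>x\<in>U. w x * (real t * \<eta> + (real t)\<^sup>2 * \<eta>))"
    unfolding avg_add
    by (intro sum_mono mult_left_mono add_mono avg_mem_le Suc assms) (auto simp: nonneg)
  also have "\<dots> = real t * \<eta> + (real t)\<^sup>2 * \<eta>"
    by (simp add: total flip: sum_distrib_right)
  also have "\<dots> \<le> (real (Suc t))\<^sup>2 * \<eta>"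
    using eta by (simp add: power2_eq_square algebra_simps)
  finally show ?case .
qed simp

end

text \<open>Erdos's theorem on complete partite hypergraphs, by induction on \<open>k\<close>:
  replace the first entry by \<open>t\<close> independent copies. By Jensen the density is still at
  least \<open>\<delta> ^ t\<close>, so some fixed distinct copies leave a dense property of the
  remaining \<open>k\<close> entries. The bound \<open>\<eta>\<close> depends on
  \<open>\<delta>\<close>, \<open>k\<close> and \<open>t\<close> alone, which makes the threshold
  for \<open>n\<close> uniform over all hypergraphs.\<close>

lemma complete_partite_blowup:
  fixes \<delta> :: real
  assumes "\<delta> > 0"
  shows "\<exists>\<eta>>0. \<forall>U w (P :: 'a list \<Rightarrow> bool). weighting U w \<longrightarrow> (\<forall>x\<in>U. w x \<le> \<eta>) \<longrightarrow>
     avg U w k (\<lambda>xs. of_bool (P xs)) \<ge> \<delta> \<longrightarrow>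
     (\<exists>As. length As = k \<and> (\<forall>A\<in>set As. A \<subseteq> U \<and> card A = t) \<and>
        (\<forall>xs. list_all2 (\<in>) xs As \<longrightarrow> P xs))"
  using assms
proof (induction k arbitrary: \<delta>)
  case 0
  have "length [] = 0" by simp
  then show ?case using 0 by (intro exI[of _ 1]) (auto split: if_splits simp: of_bool_def)
next
  case (Suc k)
  have "\<delta> ^ t / 2 > 0" using Suc.prems by simp
  from Suc.IH[OF this] obtain \<eta>0 where \<eta>0: "\<eta>0 > 0"
    and IH: "\<And>U w (P :: 'a list \<Rightarrow> bool). weighting U w \<Longrightarrow> \<forall>x\<in>U. w x \<le> \<eta>0 \<Longrightarrow>
     avg U w k (\<lambda>xs. of_bool (P xs)) \<ge> \<delta> ^ t / 2 \<Longrightarrow>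
     (\<exists>As. length As = k \<and> (\<forall>A\<in>set As. A \<subseteq> U \<and> card A = t) \<and>
        (\<forall>xs. list_all2 (\<in>) xs As \<longrightarrow> P xs))"
    by metis
  \<comment> \<open>The second term keeps the loss from repeated draws below
    \<open>\<delta> ^ t / 4\<close>; the summand 1 covers \<open>t = 0\<close>.\<close>
  define \<eta> where "\<eta> = min \<eta>0 (\<delta> ^ t / 4 / ((real t)\<^sup>2 + 1))"
  have \<eta>: "\<eta> > 0" using \<eta>0 Suc.prems by (simp add: \<eta>_def add_nonneg_pos)
  have \<eta>t: "(real t)\<^sup>2 * \<eta> \<le> \<delta> ^ t / 4"
  proof -
    have "(real t)\<^sup>2 * \<eta> \<le> ((real t)\<^sup>2 + 1) * (\<delta> ^ t / 4 / ((real t)\<^sup>2 + 1))"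
      using Suc.prems \<eta>0 by (intro mult_mono) (auto simp: \<eta>_def)
    also have "\<dots> = \<delta> ^ t / 4"
      using add_nonneg_pos[of "(real t)\<^sup>2" 1] by (simp add: field_simps)
    finally show ?thesis .
  qed
  show ?case
  proof (intro exI[of _ \<eta>] conjI allI impI \<eta>)
    fix U w and P :: "'a list \<Rightarrow> bool"
    assume W: "weighting U w" and wle: "\<forall>x\<in>U. w x \<le> \<eta>"
      and dens: "\<delta> \<le> avg U w (Suc k) (\<lambda>xs. of_bool (P xs))"
    interpret weighting U w by (rule W)
    define d where "d xs = (\<Sum>x\<in>U. w x * of_bool (P (x # xs)))" for xs
    have d0: "0 \<le> d xs" for xs unfolding d_def by (intro sum_nonneg) (simp add: nonneg)
    define h where "h ts = E k (\<lambda>xs. of_bool (\<forall>x\<in>set ts. P (x # xs)))" for ts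
    have "\<delta> \<le> E k d"
      using dens unfolding d_def by (simp add: avg_sum avg_cmult del: sum_mult_of_bool_eq)
    \<comment> \<open>Jensen in \<open>xs\<close>, then exchange of the averages:
      \<open>d xs ^ t\<close> is the probability that \<open>t\<close> independent draws all extend
      \<open>xs\<close>.\<close>
    then have "\<delta> ^ t \<le> (E k d) ^ t" using Suc.prems by (intro power_mono) auto
    also have "\<dots> \<le> E k (\<lambda>xs. d xs ^ t)" by (rule avg_power) (rule d0)
    also have "\<dots> = E t h"
      unfolding h_def d_def by (subst avg_swap) (simp only: avg_of_bool_all)
    finally have lower: "\<delta> ^ t \<le> E t h" .
    have h1: "h ts \<le> 1" for ts
      unfolding h_def using avg_mono[of k _ "\<lambda>_. 1"] by (simp add: avg_const)
    have "\<exists>ts. length ts = t \<and> set ts \<subseteq> U \<and> distinct ts \<and> \<delta> ^ t / 2 \<le> h ts"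
    proof (rule ccontr)
      assume no: "\<not> ?thesis"
      have "E t h \<le> E t (\<lambda>ts. \<delta> ^ t / 2 + of_bool (\<not> distinct ts))"
      proof (rule avg_mono)
        fix ts assume ts: "length ts = t" "set ts \<subseteq> U"
        show "h ts \<le> \<delta> ^ t / 2 + of_bool (\<not> distinct ts)"
        proof (cases "distinct ts")
          case True
          then have "\<not> \<delta> ^ t / 2 \<le> h ts" using no ts by blast
          then show ?thesis using True by simp
        next
          case False
          have "0 \<le> \<delta> ^ t" using Suc.prems by simp
          then show ?thesis using False h1[of ts] by simp
        qed
      qed
      also have "\<dots> \<le> \<delta> ^ t / 2 + \<delta> ^ t / 4"
        using avg_not_distinct_le[of \<eta> t] wle \<eta>t by (simp add: avg_add avg_const)
      also have "\<dots> < \<delta> ^ t" using Suc.prems by simp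
      finally show False using lower by simp
    qed
    then obtain ts where ts: "length ts = t" "set ts \<subseteq> U" "distinct ts" "\<delta> ^ t / 2 \<le> h ts"
      by blast
    have "\<forall>x\<in>U. w x \<le> \<eta>0" using wle by (auto simp: \<eta>_def)
    from IH[OF W this ts(4)[unfolded h_def]] obtain As where As: "length As = k"
      "\<forall>A\<in>set As. A \<subseteq> U \<and> card A = t"
      "\<And>xs. list_all2 (\<in>) xs As \<Longrightarrow> \<forall>x\<in>set ts. P (x # xs)" by blast
    show "\<exists>As. length As = Suc k \<and> (\<forall>A\<in>set As. A \<subseteq> U \<and> card A = t) \<and>
        (\<forall>xs. list_all2 (\<in>) xs As \<longrightarrow> P xs)"
      using As ts by (intro exI[of _ "set ts # As"]) (auto simp: list_all2_Cons2 distinct_card)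
  qed
qed

section \<open>Clique densities\<close>

fun clique :: "('a \<Rightarrow> 'a \<Rightarrow> bool) \<Rightarrow> 'a list \<Rightarrow> bool" where
  "clique A [] \<longleftrightarrow> True"
| "clique A (x # xs) \<longleftrightarrow> (\<forall>y\<in>set xs. A x y) \<and> clique A xs"

lemma clique_append:
  "clique A (xs @ ys) \<longleftrightarrow> clique A xs \<and> clique A ys \<and> (\<forall>x\<in>set xs. \<forall>y\<in>set ys. A x y)"
  by (induction xs) auto

lemma clique_insert_nth:
  assumes "symp A"
  shows "clique A (take i ys @ x # drop i ys) \<longleftrightarrow> (\<forall>y\<in>set ys. A x y) \<and> clique A ys"
proof -
  have "clique A ys \<longleftrightarrow> clique A (take i ys @ drop i ys)" by simp
  moreover have "set ys = set (take i ys) \<union> set (drop i ys)"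
    by (metis append_take_drop_id set_append)
  ultimately show ?thesis
    unfolding clique_append using assms by (auto dest: sympD simp: clique_append)
qed

lemma clique_nth: "clique A xs \<Longrightarrow> i < j \<Longrightarrow> j < length xs \<Longrightarrow> A (xs ! i) (xs ! j)"
proof (induction xs arbitrary: i j)
  case (Cons x xs)
  then show ?case by (cases i; cases j) simp_all
qed simp

text \<open>If \<open>Q\<close> fails at some position, deletion of any other position leaves that
  failure in place.\<close>

lemma sum_all_but_one_le:
  fixes xs :: "'a list"
  assumes "length xs = Suc s"
  shows "(\<Sum>i\<le>s. of_bool (\<forall>y\<in>set (take i xs @ drop (Suc i) xs). Q y) :: real)
           \<le> 1 + real s * of_bool (\<forall>y\<in>set xs. Q y)"
proof (cases "\<forall>y\<in>set xs. Q y")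
  case True
  then have "(\<Sum>i\<le>s. of_bool (\<forall>y\<in>set (take i xs @ drop (Suc i) xs). Q y) :: real) \<le> (\<Sum>i\<le>s. 1)"
    by (intro sum_mono) auto
  then show ?thesis using True by simp
next
  case False
  then obtain j where j: "j < length xs" "\<not> Q (xs ! j)" by (metis in_set_conv_nth)
  have "(\<Sum>i\<le>s. of_bool (\<forall>y\<in>set (take i xs @ drop (Suc i) xs). Q y) :: real)
      \<le> (\<Sum>i\<le>s. of_bool (i = j))"
  proof (intro sum_mono)
    fix i assume "i \<in> {..s}"
    have "xs ! j \<in> set (take i xs @ drop (Suc i) xs)" if "i \<noteq> j"
    proof (cases "j < i")
      case True
      then have "xs ! j = take i xs ! j" "j < length (take i xs)" using j by auto
      then show ?thesis by (metis UnCI nth_mem set_append)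
    next
      case False
      then have "xs ! j = drop (Suc i) xs ! (j - Suc i)" "j - Suc i < length (drop (Suc i) xs)"
        using j that by auto
      then show ?thesis by (metis UnCI nth_mem set_append)
    qed
    then show "(of_bool (\<forall>y\<in>set (take i xs @ drop (Suc i) xs). Q y) :: real) \<le> of_bool (i = j)"
      using j by auto
  qed
  also have "\<dots> \<le> 1" by (simp add: of_bool_def)
  finally show ?thesis using False by simp
qed

context weighting
begin

definition clique_density :: "('a \<Rightarrow> 'a \<Rightarrow> bool) \<Rightarrow> nat \<Rightarrow> real" where
  "clique_density A s = E s (\<lambda>xs. of_bool (clique A xs))"

text \<open>
  Double counting of the pairs of an \<open>(s+1)\<close>-clique \<open>xs\<close> and a vertex \<open>z\<close> joined to all but one chosen
  element of \<open>xs\<close>: there are \<open>s+1\<close> choices if \<open>z\<close> is joined to all of \<open>xs\<close>, and at most one otherwise.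
\<close>
lemma moon_moser:
  assumes A: "symp A" and \<mu>: "0 \<le> \<mu>" "\<mu> * clique_density A s \<le> clique_density A (Suc s)"
  shows "(real (Suc s) * \<mu> - 1) * clique_density A (Suc s) \<le> real s * clique_density A (Suc (Suc s))"
proof -
  define c :: "'a list \<Rightarrow> real" where "c xs = of_bool (clique A xs)" for xs
  define adj :: "'a \<Rightarrow> 'a list \<Rightarrow> real" where "adj x xs = of_bool (\<forall>y\<in>set xs. A x y)" for x xs
  define d where "d xs = (\<Sum>x\<in>U. w x * adj x xs)" for xs
  have cd: "clique_density A s = E s c" for s unfolding clique_density_def c_def ..
  have cCons: "c (x # xs) = c xs * adj x xs" for x xs by (simp add: c_def adj_def of_bool_conj)
  have cd_Suc: "clique_density A (Suc s) = E s (\<lambda>xs. c xs * d xs)" for s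
    unfolding cd avg.simps d_def cCons sum_distrib_left
    by (simp add: avg_sum mult.left_commute[of _ "w _"] avg_cmult)
  have ins: "c (take i ys @ x # drop i ys) = c ys * adj x ys" for i x ys
    using clique_insert_nth[OF A] by (simp add: c_def adj_def of_bool_conj)
  \<comment> \<open>Expanding the square at \<open>\<mu>\<close> bounds the second moment of
    \<open>d\<close> over cliques from below without dividing by a clique density that might
    vanish.\<close>
  have "0 \<le> E s (\<lambda>xs. c xs * (d xs - \<mu>)\<^sup>2)"
    by (rule avg_nonneg) (simp add: c_def)
  also have "\<dots> = E s (\<lambda>xs. c xs * (d xs)\<^sup>2 + ((- 2 * \<mu>) * (c xs * d xs) + \<mu>\<^sup>2 * c xs))"
    by (rule avg_cong) (simp add: power2_eq_square algebra_simps)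
  also have "\<dots> = E s (\<lambda>xs. c xs * (d xs)\<^sup>2) - 2 * \<mu> * clique_density A (Suc s)
      + \<mu> * (\<mu> * clique_density A s)"
    unfolding avg_add avg_cmult cd_Suc[symmetric] cd[symmetric] by (simp add: power2_eq_square)
  also have "\<dots> \<le> E s (\<lambda>xs. c xs * (d xs)\<^sup>2) - 2 * \<mu> * clique_density A (Suc s)
      + \<mu> * clique_density A (Suc s)"
    by (intro add_left_mono mult_left_mono \<mu>)
  finally have CS: "\<mu> * clique_density A (Suc s) \<le> E s (\<lambda>xs. c xs * (d xs)\<^sup>2)" by simp
  \<comment> \<open>Drawing the deleted entry contributes one more factor \<open>d\<close>, whatever
    its position.\<close>
  have del: "E (Suc s) (\<lambda>xs. c xs * d (take i xs @ drop (Suc i) xs)) = E s (\<lambda>xs. c xs * (d xs)\<^sup>2)"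
    if "i \<le> s" for i
  proof -
    have "E (Suc s) (\<lambda>xs. c xs * d (take i xs @ drop (Suc i) xs))
        = (\<Sum>x\<in>U. w x * E s (\<lambda>ys. c ys * d ys * adj x ys))"
      unfolding avg_insert_nth[OF that] using that
      by (intro sum.cong refl arg_cong[where f = "\<lambda>z. _ * z"] avg_cong) (simp add: ins)
    also have "\<dots> = E s (\<lambda>ys. \<Sum>x\<in>U. w x * (c ys * d ys * adj x ys))"
      by (simp add: avg_sum avg_cmult)
    also have "\<dots> = E s (\<lambda>ys. c ys * (d ys)\<^sup>2)"
      by (rule avg_cong) (simp add: d_def power2_eq_square sum_distrib_left mult_ac)
    finally show ?thesis .
  qed
  have "real (Suc s) * E s (\<lambda>xs. c xs * (d xs)\<^sup>2)
      = E (Suc s) (\<lambda>xs. \<Sum>i\<le>s. c xs * d (take i xs @ drop (Suc i) xs))"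
    by (simp add: avg_sum del del: avg.simps)
  also have "\<dots> \<le> E (Suc s) (\<lambda>xs. c xs + real s * (c xs * d xs))"
  proof (rule avg_mono)
    fix xs :: "'a list" assume len: "length xs = Suc s"
    have "(\<Sum>i\<le>s. c xs * d (take i xs @ drop (Suc i) xs))
        = c xs * (\<Sum>z\<in>U. w z * (\<Sum>i\<le>s. adj z (take i xs @ drop (Suc i) xs)))"
      unfolding d_def sum_distrib_left by (rule sum.swap)
    also have "\<dots> \<le> c xs * (\<Sum>z\<in>U. w z * (1 + real s * adj z xs))"
      unfolding adj_def
      by (intro mult_left_mono sum_mono sum_all_but_one_le len) (auto simp: c_def nonneg)
    also have "\<dots> = c xs + real s * (c xs * d xs)"
      by (simp add: d_def distrib_left sum.distrib total sum_distrib_left mult_ac)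
    finally show "(\<Sum>i\<le>s. c xs * d (take i xs @ drop (Suc i) xs)) \<le> c xs + real s * (c xs * d xs)" .
  qed
  also have "\<dots> = clique_density A (Suc s) + real s * clique_density A (Suc (Suc s))"
    unfolding avg_add avg_cmult cd[symmetric] cd_Suc[symmetric] ..
  finally have "real (Suc s) * E s (\<lambda>xs. c xs * (d xs)\<^sup>2)
      \<le> clique_density A (Suc s) + real s * clique_density A (Suc (Suc s))" .
  moreover have "real (Suc s) * (\<mu> * clique_density A (Suc s)) \<le> real (Suc s) * E s (\<lambda>xs. c xs * (d xs)\<^sup>2)"
    by (intro mult_left_mono CS) simp
  ultimately show ?thesis by (simp add: algebra_simps)
qed

text \<open>The form of the ratio is preserved exactly by \<open>moon_moser\<close>: if
  \<open>\<mu>\<close> is the ratio at \<open>s\<close>, then \<open>(s + 1) * \<mu> - 1\<close> is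
  \<open>s\<close> times the ratio at \<open>s + 1\<close>. The edge density is the case
  \<open>s = 1\<close>.\<close>

lemma clique_density_ratio:
  assumes A: "symp A" and \<epsilon>: "\<epsilon> > 0"
    and dens: "1 - 1 / real q + \<epsilon> \<le> (\<Sum>x\<in>U. \<Sum>y\<in>U. w x * w y * of_bool (A x y))"
    and s: "1 \<le> s" "s \<le> q"
  shows "(1 - real s / real q + real s * \<epsilon>) * clique_density A s \<le> clique_density A (Suc s)"
  using s
proof (induction s rule: dec_induct)
  case base
  have "clique_density A (Suc 0) = 1"
    by (simp add: clique_density_def total)
  moreover have "clique_density A (Suc (Suc 0)) = (\<Sum>x\<in>U. \<Sum>y\<in>U. w x * w y * of_bool (A x y))"
    by (simp add: clique_density_def sum_distrib_left mult.assoc del: sum_mult_of_bool_eq)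
  ultimately show ?case using dens by simp
next
  case (step s)
  define \<mu> where "\<mu> = 1 - real s / real q + real s * \<epsilon>"
  have q: "real s < real q" and s0: "real s > 0" using step by auto
  have "0 \<le> \<mu>" using q \<epsilon> unfolding \<mu>_def by (intro add_nonneg_nonneg) auto
  from moon_moser[OF A this, of s] step
  have "(real (Suc s) * \<mu> - 1) * clique_density A (Suc s) \<le> real s * clique_density A (Suc (Suc s))"
    by (simp add: \<mu>_def)
  also have "real (Suc s) * \<mu> - 1 = real s * (1 - real (Suc s) / real q + real (Suc s) * \<epsilon>)"
    using q s0 by (simp add: \<mu>_def field_simps)
  finally show ?case using s0 by (simp add: mult.assoc)
qed

text \<open>Up to \<open>s = q\<close> each ratio is at least \<open>\<epsilon>\<close>. At
  \<open>s = q\<close> only its \<open>\<epsilon>\<close> part survives, and this last step produces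
  the cliques of size \<open>q + 1\<close>.\<close>

lemma clique_density_ge_power:
  assumes A: "symp A" and \<epsilon>: "\<epsilon> > 0"
    and dens: "1 - 1 / real q + \<epsilon> \<le> (\<Sum>x\<in>U. \<Sum>y\<in>U. w x * w y * of_bool (A x y))"
    and "s \<le> q"
  shows "\<epsilon> ^ s \<le> clique_density A (Suc s)"
  using \<open>s \<le> q\<close>
proof (induction s)
  case 0
  show ?case by (simp add: clique_density_def total)
next
  case (Suc s)
  have "\<epsilon> ^ Suc s \<le> \<epsilon> * clique_density A (Suc s)" using Suc \<epsilon> by simp
  also have "\<dots> \<le> (1 - real (Suc s) / real q + real (Suc s) * \<epsilon>) * clique_density A (Suc s)"
  proof (rule mult_right_mono)
    have "real (Suc s) / real q \<le> 1" using Suc.prems by (simp add: divide_simps)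
    moreover have "1 * \<epsilon> \<le> real (Suc s) * \<epsilon>" using \<epsilon> by (intro mult_right_mono) auto
    ultimately show "\<epsilon> \<le> 1 - real (Suc s) / real q + real (Suc s) * \<epsilon>" by simp
    show "0 \<le> clique_density A (Suc s)"
      unfolding clique_density_def by (rule avg_nonneg) simp
  qed
  also have "\<dots> \<le> clique_density A (Suc (Suc s))"
    by (rule clique_density_ratio[OF A \<epsilon> dens]) (use Suc.prems in auto)
  finally show ?case .
qed

end

section \<open>Eigenvalues and the 2-shadow\<close>

lemma prod_le_sum_power:
  fixes a :: "'a \<Rightarrow> real"
  assumes "finite S" "S \<noteq> {}" "\<And>j. j \<in> S \<Longrightarrow> 0 \<le> a j"
  shows "(\<Prod>j\<in>S. a j) \<le> (\<Sum>j\<in>S. a j ^ card S) / real (card S)"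
proof -
  define c where "c = card S"
  define P where "P = (\<Prod>j\<in>S. a j)"
  have c: "c > 0" using assms by (simp add: c_def card_gt_0_iff)
  have P: "P \<ge> 0" unfolding P_def by (intro prod_nonneg) (use assms in auto)
  have "P = (P ^ c) powr (1 / real c)"
    using P c by (cases "P = 0") (simp_all add: powr_powr flip: powr_realpow)
  also have "\<dots> = (\<Prod>j\<in>S. a j ^ c) powr (1 / real c)"
    by (simp add: P_def prod_power_distrib)
  also have "\<dots> \<le> (\<Sum>j\<in>S. a j ^ c / real c)"
    unfolding c_def by (rule arith_geom_mean) (use assms in auto)
  finally show ?thesis by (simp add: P_def c_def sum_divide_distrib)
qed

lemma card_inj_funcset:
  assumes "finite A" "finite B" "card A = card B"
  shows "card {f \<in> A \<rightarrow>\<^sub>E B. inj_on f A} = fact (card B)"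
  using card_inj_on_subset_funcset[OF assms(1,2) order.refl] assms(3) by (simp add: fact_prod_rev)

text \<open>Only tuples that enumerate \<open>e - {i}\<close> without repetition contribute: a
  repeated entry or an entry \<open>i\<close> leaves fewer than \<open>r\<close> vertices. The
  \<open>(r - 1)!\<close> enumerations of each edge cancel the normalisation of the tensor.\<close>

lemma adj_tensor_sum:
  fixes x :: "nat \<Rightarrow> complex"
  assumes EH: "\<forall>e\<in>EH. e \<subseteq> {..<n} \<and> card e = r" and r: "1 \<le> r"
  shows "(\<Sum>t\<in>{..<r - 1} \<rightarrow>\<^sub>E {..<n}. adj_tensor r EH i t * (\<Prod>m<r - 1. x (t m)))
       = (\<Sum>e | e \<in> EH \<and> i \<in> e. \<Prod>j\<in>e - {i}. x j)"
proof -
  let ?F = "{..<r - 1} \<rightarrow>\<^sub>E {..<n}"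
  let ?g = "\<lambda>t. adj_tensor r EH i t * (\<Prod>m<r - 1. x (t m))"
  define T where "T e = {t \<in> {..<r - 1} \<rightarrow>\<^sub>E (e - {i}). inj_on t {..<r - 1}}" for e
  define I where "I = {e. e \<in> EH \<and> i \<in> e}"
  have finEH: "finite EH" by (rule finite_subset[of _ "Pow {..<n}"]) (use EH in auto)
  then have finI: "finite I" by (simp add: I_def)
  have e: "finite e" "card (e - {i}) = r - 1" "e \<subseteq> {..<n}" if "e \<in> I" for e
    using that EH by (auto simp: I_def intro: finite_subset)
  have onto: "t ` {..<r - 1} = e - {i}" if "e \<in> I" "t \<in> T e" for e t
  proof (rule card_subset_eq)
    show "finite (e - {i})" using e[OF that(1)] by simp
    show "t ` {..<r - 1} \<subseteq> e - {i}" using that by (auto simp: T_def)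
    show "card (t ` {..<r - 1}) = card (e - {i})"
      using that e[OF that(1)] by (simp add: T_def card_image)
  qed
  have ins: "insert i (t ` {..<r - 1}) = e" if "e \<in> I" "t \<in> T e" for e t
    using onto[OF that] that by (auto simp: I_def)
  have sub: "(\<Union>e\<in>I. T e) \<subseteq> ?F"
  proof
    fix t assume "t \<in> (\<Union>e\<in>I. T e)"
    then obtain e where "e \<in> I" "t \<in> {..<r - 1} \<rightarrow>\<^sub>E (e - {i})" by (auto simp: T_def)
    then show "t \<in> ?F" using PiE_mono[of "{..<r - 1}" "\<lambda>_. e - {i}" "\<lambda>_. {..<n}"] e(3) by blast
  qed
  have "(\<Sum>t\<in>?F. ?g t) = (\<Sum>t\<in>(\<Union>e\<in>I. T e). ?g t)"
  proof (rule sum.mono_neutral_right)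
    show "finite ?F" by (intro finite_PiE) auto
    show "\<forall>t\<in>?F - (\<Union>e\<in>I. T e). ?g t = 0"
    proof
      fix t assume t: "t \<in> ?F - (\<Union>e\<in>I. T e)"
      have "insert i (t ` {..<r - 1}) \<notin> EH"
      proof
        let ?e = "insert i (t ` {..<r - 1})"
        assume "?e \<in> EH"
        then have c: "card ?e = r" and eI: "?e \<in> I" using EH by (auto simp: I_def)
        have le: "card (t ` {..<r - 1}) \<le> r - 1" using card_image_le[of "{..<r - 1}" t] by simp
        have ni: "i \<notin> t ` {..<r - 1}"
        proof
          assume "i \<in> t ` {..<r - 1}"
          then have "card ?e = card (t ` {..<r - 1})" by (simp add: insert_absorb)
          then show False using le c r by simp
        qed
        then have "card (t ` {..<r - 1}) = r - 1" using c r by simp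
        then have "inj_on t {..<r - 1}" by (simp add: eq_card_imp_inj_on)
        moreover have "t \<in> {..<r - 1} \<rightarrow>\<^sub>E (?e - {i})" using t ni by (auto simp: PiE_iff)
        ultimately have "t \<in> T ?e" by (simp add: T_def)
        then show False using t eI by blast
      qed
      then show "?g t = 0" by (simp add: adj_tensor_def)
    qed
  qed (rule sub)
  also have "\<dots> = (\<Sum>e\<in>I. \<Sum>t\<in>T e. ?g t)"
  proof (rule sum.UNION_disjoint[OF finI])
    have "finite ?F" by (intro finite_PiE) auto
    then have "finite (\<Union>e\<in>I. T e)" by (rule finite_subset[OF sub])
    then show "\<forall>e\<in>I. finite (T e)" by (simp add: finI)
    show "\<forall>e\<in>I. \<forall>f\<in>I. e \<noteq> f \<longrightarrow> T e \<inter> T f = {}"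
    proof (intro ballI impI equals0I)
      fix e f t assume "e \<in> I" "f \<in> I" "e \<noteq> f" "t \<in> T e \<inter> T f"
      then show False using ins[of e t] ins[of f t] by simp
    qed
  qed
  also have "\<dots> = (\<Sum>e\<in>I. \<Prod>j\<in>e - {i}. x j)"
  proof (rule sum.cong[OF refl])
    fix e assume eI: "e \<in> I"
    have "?g t = (\<Prod>j\<in>e - {i}. x j) / of_nat (fact (r - 1))" if "t \<in> T e" for t
    proof -
      have "(\<Prod>m<r - 1. x (t m)) = (\<Prod>j\<in>t ` {..<r - 1}. x j)"
        using that by (subst prod.reindex) (auto simp: T_def)
      then show ?thesis
        using onto[OF eI that] ins[OF eI that] eI by (simp add: adj_tensor_def I_def)
    qed
    then have "(\<Sum>t\<in>T e. ?g t) = of_nat (card (T e)) * ((\<Prod>j\<in>e - {i}. x j) / of_nat (fact (r - 1)))"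
      by simp
    also have "card (T e) = fact (r - 1)"
      unfolding T_def using card_inj_funcset[of "{..<r - 1}" "e - {i}"] e[OF eI] by simp
    finally show "(\<Sum>t\<in>T e. ?g t) = (\<Prod>j\<in>e - {i}. x j)" by simp
  qed
  finally show ?thesis by (simp add: I_def)
qed

definition shadow :: "'a set set \<Rightarrow> 'a \<Rightarrow> 'a \<Rightarrow> bool" where
  "shadow EH i j \<longleftrightarrow> i \<noteq> j \<and> (\<exists>e\<in>EH. i \<in> e \<and> j \<in> e)"

lemma symp_shadow: "symp (shadow EH)"
  by (auto simp: symp_def shadow_def)

lemma linear_uniform_hg_finite: "linear_uniform_hg r n EH \<Longrightarrow> finite EH"
  by (rule finite_subset[of _ "Pow {..<n}"]) (auto simp: linear_uniform_hg_def)

lemma linear_uniform_hg_eqI: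
  assumes "linear_uniform_hg r n EH" "e \<in> EH" "f \<in> EH" "{u, v} \<subseteq> e \<inter> f" "u \<noteq> v"
  shows "e = f"
proof (rule ccontr)
  assume "e \<noteq> f"
  then have "card (e \<inter> f) \<le> 1" using assms(1-3) by (simp add: linear_uniform_hg_def)
  moreover have "finite e" using assms(1,2) by (auto simp: linear_uniform_hg_def intro: finite_subset)
  moreover have "card {u, v} = 2" using assms(5) by simp
  ultimately show False using card_mono[of "e \<inter> f" "{u, v}"] assms(4) by simp
qed

text \<open>The exponent \<open>r - 1\<close> makes both sides linear in \<open>y\<close>: it is the
  exponent in the eigenvalue equation and also the number of factors in each product, to which AM-GM
  applies.\<close>

lemma hg_eigenvalue_shadow:
  assumes H: "linear_uniform_hg r n EH" and r: "2 \<le> r" and ev: "hg_eigenvalue r n EH lam"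
  obtains y :: "nat \<Rightarrow> real" where "\<And>i. 0 \<le> y i" "0 < (\<Sum>i<n. y i)"
    "\<And>i. i < n \<Longrightarrow> real (r - 1) * cmod lam * y i \<le> (\<Sum>j<n. y j * of_bool (shadow EH i j))"
proof -
  obtain x i0 where x0: "i0 < n" "x i0 \<noteq> 0" and x: "\<And>i. i < n \<Longrightarrow>
      (\<Sum>t\<in>{..<r - 1} \<rightarrow>\<^sub>E {..<n}. adj_tensor r EH i t * (\<Prod>m<r - 1. x (t m))) = lam * x i ^ (r - 1)"
    using ev unfolding hg_eigenvalue_def by blast
  define y where "y i = cmod (x i) ^ (r - 1)" for i
  have EH: "\<forall>e\<in>EH. e \<subseteq> {..<n} \<and> card e = r" using H by (simp add: linear_uniform_hg_def)
  show thesis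
  proof
    show "0 \<le> y i" for i by (simp add: y_def)
    have "0 < y i0" using x0 by (simp add: y_def)
    also have "\<dots> \<le> (\<Sum>i<n. y i)"
      by (rule member_le_sum) (use x0 in \<open>auto simp: y_def\<close>)
    finally show "0 < (\<Sum>i<n. y i)" .
    fix i assume i: "i < n"
    define I where "I = {e. e \<in> EH \<and> i \<in> e}"
    have finI: "finite I" using linear_uniform_hg_finite[OF H] by (simp add: I_def)
    have fine: "finite e" "card (e - {i}) = r - 1" if "e \<in> I" for e
      using that EH by (auto simp: I_def intro: finite_subset)
    have "lam * x i ^ (r - 1) = (\<Sum>e\<in>I. \<Prod>j\<in>e - {i}. x j)"
      using x[OF i] adj_tensor_sum[OF EH, of i x] r by (simp add: I_def)
    then have "cmod lam * y i = cmod (\<Sum>e\<in>I. \<Prod>j\<in>e - {i}. x j)"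
      by (metis norm_mult norm_power y_def)
    also have "\<dots> \<le> (\<Sum>e\<in>I. \<Prod>j\<in>e - {i}. cmod (x j))"
      by (rule order.trans[OF norm_sum]) (simp add: prod_norm)
    also have "\<dots> \<le> (\<Sum>e\<in>I. (\<Sum>j\<in>e - {i}. y j) / real (r - 1))"
    proof (rule sum_mono)
      fix e assume e: "e \<in> I"
      have "card (e - {i}) > 0" using fine[OF e] r by simp
      then have "e - {i} \<noteq> {}" by (metis card.empty less_irrefl)
      then show "(\<Prod>j\<in>e - {i}. cmod (x j)) \<le> (\<Sum>j\<in>e - {i}. y j) / real (r - 1)"
        using prod_le_sum_power[of "e - {i}" "\<lambda>j. cmod (x j)"] fine[OF e]
        by (simp add: y_def)
    qed
    also have "\<dots> = (\<Sum>e\<in>I. \<Sum>j\<in>e - {i}. y j) / real (r - 1)"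
      by (simp add: sum_divide_distrib)
    \<comment> \<open>By linearity the edges through \<open>i\<close> are disjoint outside
      \<open>i\<close>, so each shadow neighbour is counted once.\<close>
    also have "(\<Sum>e\<in>I. \<Sum>j\<in>e - {i}. y j) = (\<Sum>j\<in>(\<Union>e\<in>I. e - {i}). y j)"
    proof (rule sum.UNION_disjoint[symmetric, OF finI])
      show "\<forall>e\<in>I. finite (e - {i})" using fine by auto
      show "\<forall>e\<in>I. \<forall>f\<in>I. e \<noteq> f \<longrightarrow> (e - {i}) \<inter> (f - {i}) = {}"
      proof (intro ballI impI equals0I)
        fix e f j assume "e \<in> I" "f \<in> I" "e \<noteq> f" "j \<in> (e - {i}) \<inter> (f - {i})"
        then show False using linear_uniform_hg_eqI[OF H, of e f i j] by (auto simp: I_def)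
      qed
    qed
    also have "(\<Union>e\<in>I. e - {i}) = {..<n} \<inter> {j. shadow EH i j}"
      using EH unfolding I_def shadow_def by blast
    also have "(\<Sum>j\<in>{..<n} \<inter> {j. shadow EH i j}. y j) = (\<Sum>j<n. y j * of_bool (shadow EH i j))"
      by simp
    finally show "real (r - 1) * cmod lam * y i \<le> (\<Sum>j<n. y j * of_bool (shadow EH i j))"
      using r by (simp add: field_simps)
  qed
qed

text \<open>With \<open>\<mu> = (r - 1) * cmod lam\<close>, each row gives
  \<open>\<mu> * w i \<le> 1\<close>. Weighting the rows by \<open>w\<close> and summing gives
  density at least \<open>\<mu>\<close> times the sum of squares, which is at least
  \<open>1 / n\<close> by Cauchy-Schwarz.\<close>

lemma hg_eigenvalue_weighting:
  assumes H: "linear_uniform_hg r n EH" and r: "2 \<le> r" and ev: "hg_eigenvalue r n EH lam"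
    and "lam \<noteq> 0"
  obtains w where "weighting {..<n} w" "\<And>i. i < n \<Longrightarrow> w i \<le> 1 / (real (r - 1) * cmod lam)"
    "real (r - 1) * cmod lam / real n
       \<le> (\<Sum>i<n. \<Sum>j<n. w i * w j * of_bool (shadow EH i j))"
proof -
  define \<mu> where "\<mu> = real (r - 1) * cmod lam"
  have \<mu>: "\<mu> > 0" using r \<open>lam \<noteq> 0\<close> by (simp add: \<mu>_def)
  obtain y :: "nat \<Rightarrow> real" where y: "\<And>i. 0 \<le> y i" "0 < (\<Sum>i<n. y i)"
    "\<And>i. i < n \<Longrightarrow> \<mu> * y i \<le> (\<Sum>j<n. y j * of_bool (shadow EH i j))"
    using hg_eigenvalue_shadow[OF H r ev, folded \<mu>_def] by blast
  define S where "S = (\<Sum>i<n. y i)"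
  have S: "S > 0" using y by (simp add: S_def)
  define w where "w i = y i / S" for i
  have n: "real n > 0" using y(2) by (cases "n = 0") auto
  have w: "\<mu> * w i \<le> (\<Sum>j<n. w j * of_bool (shadow EH i j))" if "i < n" for i
    using divide_right_mono[OF y(3)[OF that], of S] S
    by (simp add: w_def sum_divide_distrib del: sum_mult_of_bool_eq)
  have tot: "(\<Sum>i<n. w i) = 1" using S by (simp add: w_def S_def flip: sum_divide_distrib)
  have w0: "0 \<le> w i" for i using y S by (simp add: w_def)
  have W: "weighting {..<n} w" by unfold_locales (use w0 tot in auto)
  show thesis
  proof (rule that[OF W]; (fold \<mu>_def)?)
    fix i assume i: "i < n"
    have "\<mu> * w i \<le> (\<Sum>j<n. w j * 1)"
      by (rule order.trans[OF w[OF i]], intro sum_mono mult_left_mono) (auto simp: w0)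
    then show "w i \<le> 1 / \<mu>" using \<mu> tot by (simp add: field_simps)
  next
    have "1 = (\<Sum>i<n. 1 * w i)\<^sup>2" using tot by simp
    also have "\<dots> \<le> (\<Sum>i<n. 1\<^sup>2) * (\<Sum>i<n. (w i)\<^sup>2)" by (rule Cauchy_Schwarz_ineq_sum)
    finally have "1 / real n \<le> (\<Sum>i<n. (w i)\<^sup>2)" using n by (simp add: field_simps)
    then have "\<mu> * (1 / real n) \<le> \<mu> * (\<Sum>i<n. (w i)\<^sup>2)" using \<mu> by (intro mult_left_mono) auto
    also have "\<dots> = (\<Sum>i<n. w i * (\<mu> * w i))"
      by (simp add: sum_distrib_left power2_eq_square mult_ac)
    also have "\<dots> \<le> (\<Sum>i<n. w i * (\<Sum>j<n. w j * of_bool (shadow EH i j)))"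
      by (intro sum_mono mult_left_mono w) (auto simp: w0)
    also have "\<dots> = (\<Sum>i<n. \<Sum>j<n. w i * w j * of_bool (shadow EH i j))"
      by (simp add: sum_distrib_left mult.assoc del: sum_mult_of_bool_eq)
    finally show "\<mu> / real n \<le> (\<Sum>i<n. \<Sum>j<n. w i * w j * of_bool (shadow EH i j))" by simp
  qed
qed

text \<open>Crude, but it bounds the moduli of the eigenvalues, so that \<open>Sup\<close> in
  \<open>hg_spectral_radius\<close> is an upper bound for them.\<close>

lemma hg_eigenvalue_le:
  assumes H: "linear_uniform_hg r n EH" and r: "2 \<le> r" and ev: "hg_eigenvalue r n EH lam"
  shows "cmod lam \<le> real n"
proof (cases "lam = 0")
  case False
  obtain w where W: "weighting {..<n} w" and
    le: "real (r - 1) * cmod lam / real n \<le> (\<Sum>i<n. \<Sum>j<n. w i * w j * of_bool (shadow EH i j))"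
    by (rule hg_eigenvalue_weighting[OF H r ev False])
  interpret weighting "{..<n}" w by (rule W)
  have "(\<Sum>i<n. \<Sum>j<n. w i * w j * of_bool (shadow EH i j)) \<le> (\<Sum>i<n. \<Sum>j<n. w i * w j * 1)"
    by (intro sum_mono mult_left_mono) (auto simp: nonneg)
  also have "\<dots> = 1" by (simp add: total flip: sum_distrib_left)
  finally have "real (r - 1) * cmod lam / real n \<le> 1" using le by simp
  moreover have "real n > 0" using total by (cases "n = 0") auto
  ultimately have "real (r - 1) * cmod lam \<le> real n" by (simp add: field_simps)
  moreover have "1 * cmod lam \<le> real (r - 1) * cmod lam" using r by (intro mult_right_mono) auto
  ultimately show ?thesis by simp
qed simp

text \<open>The indicator of \<open>C\<close> is an eigenvector for \<open>d\<close>. Vertices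
  outside \<open>C\<close> are isolated, which permits padding a regular hypergraph up to
  \<open>n\<close> vertices.\<close>

lemma hg_spectral_radius_ge_degree:
  assumes H: "linear_uniform_hg r n EH" and r: "2 \<le> r"
    and C: "C \<subseteq> {..<n}" "C \<noteq> {}" "\<And>e. e \<in> EH \<Longrightarrow> e \<subseteq> C"
    and deg: "\<And>i. i \<in> C \<Longrightarrow> card {e \<in> EH. i \<in> e} = d"
  shows "real d \<le> hg_spectral_radius r n EH"
proof -
  have EH: "\<forall>e\<in>EH. e \<subseteq> {..<n} \<and> card e = r" using H by (simp add: linear_uniform_hg_def)
  define x :: "nat \<Rightarrow> complex" where "x i = of_bool (i \<in> C)" for i
  have "hg_eigenvalue r n EH (of_nat d)"
    unfolding hg_eigenvalue_def
  proof (intro exI[of _ x] conjI allI impI)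
    show "\<exists>i<n. x i \<noteq> 0" using C by (auto simp: x_def)
    fix i assume "i < n"
    have "(\<Sum>t\<in>{..<r - 1} \<rightarrow>\<^sub>E {..<n}. adj_tensor r EH i t * (\<Prod>m<r - 1. x (t m)))
        = (\<Sum>e | e \<in> EH \<and> i \<in> e. \<Prod>j\<in>e - {i}. x j)"
      by (rule adj_tensor_sum[OF EH]) (use r in simp)
    also have "\<dots> = (\<Sum>e | e \<in> EH \<and> i \<in> e. 1)"
      using C(3) by (intro sum.cong refl prod.neutral) (auto simp: x_def)
    also have "\<dots> = of_nat d * x i ^ (r - 1)"
    proof (cases "i \<in> C")
      case False
      then have "card {e \<in> EH. i \<in> e} = 0" using C(3) by (auto simp: card_eq_0_iff)
      then show ?thesis using False r by (simp add: x_def power_0_left)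
    qed (use deg in \<open>simp add: x_def\<close>)
    finally show "(\<Sum>t\<in>{..<r - 1} \<rightarrow>\<^sub>E {..<n}. adj_tensor r EH i t * (\<Prod>m<r - 1. x (t m)))
        = of_nat d * x i ^ (r - 1)" .
  qed
  moreover have "bdd_above (cmod ` {lam. hg_eigenvalue r n EH lam})"
    using hg_eigenvalue_le[OF H r] by (intro bdd_aboveI[of _ "real n"]) auto
  ultimately have "cmod (of_nat d) \<le> hg_spectral_radius r n EH"
    unfolding hg_spectral_radius_def by (intro cSup_upper imageI CollectI)
  then show ?thesis by simp
qed

section \<open>Embedding expansions greedily\<close>

lemma finite_expansion_vertices:
  fixes V :: "'a set"
  assumes "finite V" "finite E"
  shows "finite (expansion_vertices r V E)"
proof -
  have "{Inr (e, i) | e i. e \<in> E \<and> i < r - 2}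
      = (Inr ` (E \<times> {..<r - 2}) :: ('a + 'a set \<times> nat) set)" by auto
  then show ?thesis using assms by (simp add: expansion_vertices_def)
qed

text \<open>Bounds the vertices that the greedy embedding must avoid: two vertices of
  \<open>Z\<close> lie in at most one common edge, so there are at most \<open>(card Z)^2\<close>
  such edges. Pairs without an edge only add arbitrary values to the image of
  \<open>f\<close>.\<close>

lemma card_Union_dense_edges_le:
  assumes H: "linear_uniform_hg r n EH" and Z: "finite Z"
  shows "card (\<Union>{e\<in>EH. \<exists>u\<in>Z. \<exists>v\<in>Z. u \<noteq> v \<and> u \<in> e \<and> v \<in> e}) \<le> (card Z)\<^sup>2 * r"
proof -
  let ?D = "{e\<in>EH. \<exists>u\<in>Z. \<exists>v\<in>Z. u \<noteq> v \<and> u \<in> e \<and> v \<in> e}"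
  define f where "f p = (THE e. e \<in> EH \<and> fst p \<in> e \<and> snd p \<in> e)" for p
  have "?D \<subseteq> f ` (Z \<times> Z)"
  proof
    fix e assume "e \<in> ?D"
    then obtain u v where uv: "u \<in> Z" "v \<in> Z" "u \<noteq> v" "u \<in> e" "v \<in> e" "e \<in> EH" by blast
    have "f (u, v) = e"
      unfolding f_def
    proof (rule the_equality)
      fix e' assume "e' \<in> EH \<and> fst (u, v) \<in> e' \<and> snd (u, v) \<in> e'"
      then show "e' = e" using linear_uniform_hg_eqI[OF H, of e' e u v] uv by simp
    qed (use uv in simp)
    then show "e \<in> f ` (Z \<times> Z)" using uv by force
  qed
  then have "card ?D \<le> card (f ` (Z \<times> Z))" by (intro card_mono) (simp_all add: Z)
  also have "\<dots> \<le> (card Z)\<^sup>2"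
    using card_image_le[of "Z \<times> Z" f] Z by (simp add: card_cartesian_product power2_eq_square)
  finally have D: "card ?D \<le> (card Z)\<^sup>2" .
  have "card (\<Union>?D) \<le> sum card ?D" by (rule card_Union_le_sum_card)
  also have "\<dots> = card ?D * r" using H by (simp add: linear_uniform_hg_def)
  also have "\<dots> \<le> (card Z)\<^sup>2 * r" using D by simp
  finally show ?thesis .
qed

text \<open>The core vertices are placed one at a time. The size of the parts is what one placement
  needs: at most \<open>K\<close> vertices are in use, and at most \<open>K\<^sup>2 * r\<close> lie
  in edges that meet the used set twice.\<close>

lemma contains_expansion_greedy:
  fixes V :: "'a set" and E :: "'a set set" and A :: "nat \<Rightarrow> nat set"
  assumes H: "linear_uniform_hg r n EH"
    and r: "2 \<le> r"
    and V: "finite V" and E: "\<forall>e\<in>E. e \<subseteq> V \<and> card e = 2"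
    and c: "\<forall>e\<in>E. \<forall>u\<in>e. \<forall>v\<in>e. u \<noteq> v \<longrightarrow> c u \<noteq> c v"
    and K: "K = card (expansion_vertices r V E)"
    and A: "\<And>v. v \<in> V \<Longrightarrow> A (c v) \<subseteq> {..<n}" "\<And>v. v \<in> V \<Longrightarrow> K + K\<^sup>2 * r < card (A (c v))"
    and sh: "\<And>u v x y. u \<in> V \<Longrightarrow> v \<in> V \<Longrightarrow> c u \<noteq> c v \<Longrightarrow> x \<in> A (c u) \<Longrightarrow> y \<in> A (c v) \<Longrightarrow>
                shadow EH x y"
  shows "contains_copy {..<n} EH (expansion_vertices r V E) (expansion_edges r E)"
proof -
  let ?E = "\<lambda>W. {e\<in>E. e \<subseteq> W}"
  let ?X = "\<lambda>W. expansion_vertices r W (?E W)"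
  have finE: "finite E" by (rule finite_subset[of _ "Pow V"]) (use E V in auto)
  \<comment> \<open>The invariant embeds the expansion of the subgraph induced on \<open>W\<close>,
    and it keeps each core vertex in the part of its colour so that the next vertex is adjacent to
    it.\<close>
  have "\<exists>\<phi>. inj_on \<phi> (?X W) \<and> \<phi> ` (?X W) \<subseteq> {..<n} \<and> (\<forall>f\<in>expansion_edges r (?E W). \<phi> ` f \<in> EH)
      \<and> (\<forall>v\<in>W. \<phi> (Inl v) \<in> A (c v))" if "finite W" "W \<subseteq> V" for W
    using that
  proof (induction W rule: finite_induct)
    case empty
    have "?E {} = {}" using E by auto
    then show ?case by (auto simp: expansion_vertices_def expansion_edges_def)
  next
    case (insert w W)
    have WV: "W \<subseteq> V" "w \<in> V" using insert.prems by auto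
    from insert.IH[OF WV(1)] obtain \<phi> where inj: "inj_on \<phi> (?X W)" and im: "\<phi> ` (?X W) \<subseteq> {..<n}"
      and ed: "\<And>f. f \<in> expansion_edges r (?E W) \<Longrightarrow> \<phi> ` f \<in> EH"
      and \<phi>A: "\<And>v. v \<in> W \<Longrightarrow> \<phi> (Inl v) \<in> A (c v)" by blast
    define Z where "Z = \<phi> ` (?X W)"
    have X: "finite (expansion_vertices r V E)" by (rule finite_expansion_vertices[OF V finE])
    have sub: "?X W \<subseteq> expansion_vertices r V E"
      using WV by (auto simp: expansion_vertices_def)
    then have fX: "finite (?X W)" by (rule finite_subset[OF _ X])
    then have Z: "finite Z" by (simp add: Z_def)
    have "card Z \<le> card (?X W)" unfolding Z_def by (rule card_image_le[OF fX])
    also have "\<dots> \<le> K" unfolding K by (rule card_mono[OF X sub])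
    finally have cZ: "card Z \<le> K" .
    have ZX: "\<phi> p \<in> Z" if "p \<in> ?X W" for p using that by (simp add: Z_def)
    have InlX: "Inl v \<in> ?X W" if "v \<in> W" for v using that by (simp add: expansion_vertices_def)
    \<comment> \<open>A vertex outside \<open>Z\<close> and outside the edges with two vertices in \<open>Z\<close> can be joined to the
      images of its neighbours by edges that meet \<open>Z\<close> and each other only where they must.\<close>
    define D where "D = {e\<in>EH. \<exists>u\<in>Z. \<exists>v\<in>Z. u \<noteq> v \<and> u \<in> e \<and> v \<in> e}"
    have "card (Z \<union> \<Union>D) \<le> card Z + card (\<Union>D)" by (rule card_Un_le)
    also have "\<dots> \<le> K + K\<^sup>2 * r"
    proof -
      have "(card Z)\<^sup>2 * r \<le> K\<^sup>2 * r" using cZ by (intro mult_right_mono power_mono) auto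
      then show ?thesis
        using card_Union_dense_edges_le[OF H Z] cZ unfolding D_def by linarith
    qed
    also have "\<dots> < card (A (c w))" by (rule A(2)[OF WV(2)])
    finally have lt: "card (Z \<union> \<Union>D) < card (A (c w))" .
    have "\<Union>D \<subseteq> {..<n}" using H by (auto simp: D_def linear_uniform_hg_def)
    then have "finite (\<Union>D)" by (rule finite_subset) simp
    then have "finite (Z \<union> \<Union>D)" using Z by simp
    then have "\<not> A (c w) \<subseteq> Z \<union> \<Union>D" using lt card_mono[of "Z \<union> \<Union>D" "A (c w)"] by auto
    then obtain z where z: "z \<in> A (c w)" "z \<notin> Z" "z \<notin> \<Union>D" by blast
    define N where "N = {u\<in>W. {u, w} \<in> E}"
    have NW: "u \<in> W" "u \<noteq> w" "{u, w} \<in> E" if "u \<in> N" for u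
      using that insert.hyps by (auto simp: N_def)
    have "\<exists>e. e \<in> EH \<and> \<phi> (Inl u) \<in> e \<and> z \<in> e" if "u \<in> N" for u
    proof -
      have "c u \<noteq> c w" using c[rule_format, OF NW(3)[OF that], of u w] NW(2)[OF that] by simp
      then have "shadow EH (\<phi> (Inl u)) z"
        using WV NW(1)[OF that] by (intro sh[of u w] \<phi>A z) auto
      then show ?thesis by (auto simp: shadow_def)
    qed
    then obtain g where g: "\<And>u. u \<in> N \<Longrightarrow> g u \<in> EH" "\<And>u. u \<in> N \<Longrightarrow> \<phi> (Inl u) \<in> g u"
      "\<And>u. u \<in> N \<Longrightarrow> z \<in> g u" by metis
    have uZ: "\<phi> (Inl u) \<in> Z" if "u \<in> N" for u using ZX InlX NW(1) that by simp
    \<comment> \<open>A second vertex in \<open>Z\<close> would put \<open>g u\<close> into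
      \<open>D\<close>, but \<open>z\<close> lies on \<open>g u\<close> and on no edge of
      \<open>D\<close>.\<close>
    have gZ: "x = \<phi> (Inl u)" if "u \<in> N" "x \<in> g u" "x \<in> Z" for u x
    proof (rule ccontr)
      assume "x \<noteq> \<phi> (Inl u)"
      then have "g u \<in> D"
        using that g(1,2)[OF that(1)] uZ[OF that(1)] unfolding D_def by blast
      then show False using z(3) g(3)[OF that(1)] by blast
    qed
    have "\<exists>h. bij_betw h {..<r - 2} (g u - {\<phi> (Inl u), z})" if "u \<in> N" for u
    proof -
      have "finite (g u)" "card (g u) = r"
        using g(1)[OF that] H by (auto simp: linear_uniform_hg_def intro: finite_subset)
      moreover have "\<phi> (Inl u) \<noteq> z" using z uZ[OF that] by auto
      ultimately have "card (g u - {\<phi> (Inl u), z}) = r - 2"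
        using g that by (simp add: card_Diff_subset)
      then show ?thesis using \<open>finite (g u)\<close> by (intro finite_same_card_bij) auto
    qed
    then obtain h where h: "\<And>u. u \<in> N \<Longrightarrow> bij_betw (h u) {..<r - 2} (g u - {\<phi> (Inl u), z})"
      by metis
    have hg: "h u i \<in> g u" "h u i \<noteq> z" "h u i \<noteq> \<phi> (Inl u)" if "u \<in> N" "i < r - 2" for u i
      using bij_betwE[OF h[OF that(1)]] that by auto
    have hZ: "h u i \<notin> Z" if "u \<in> N" "i < r - 2" for u i
      using gZ[OF that(1) hg(1)[OF that]] hg(3)[OF that] by blast
    \<comment> \<open>Two new edges that share a vertex besides \<open>z\<close> coincide by
      linearity, and then so do their vertices in \<open>Z\<close>.\<close>
    have hinj: "u = u' \<and> i = i'" if "u \<in> N" "i < r - 2" "u' \<in> N" "i' < r - 2" "h u i = h u' i'"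
      for u i u' i'
    proof -
      have "g u = g u'"
        by (rule linear_uniform_hg_eqI[OF H, of _ _ z "h u i"])
          (use g hg[OF that(1,2)] hg[OF that(3,4)] that in auto)
      then have "\<phi> (Inl u') = \<phi> (Inl u)" using gZ[OF that(1)] g(2)[OF that(3)] uZ[OF that(3)] by simp
      then have "u = u'"
        using inj_onD[OF inj _ InlX[OF NW(1)[OF that(3)]] InlX[OF NW(1)[OF that(1)]]] by simp
      then show ?thesis
        using bij_betw_imp_inj_on[OF h[OF that(1)]] that by (auto dest: inj_onD)
    qed
    define other where "other e = (THE u. u \<in> e - {w})" for e
    have other: "other {u, w} = u" if "u \<in> N" for u
      unfolding other_def using NW[OF that] by (intro the_equality) auto
    \<comment> \<open>The expansion vertices of \<open>{u, w}\<close> receive the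
      \<open>r - 2\<close> remaining vertices of the forced edge \<open>g u\<close>.\<close>
    define \<psi> where "\<psi> p = (case p of Inl v \<Rightarrow> if v = w then z else \<phi> p
        | Inr (e, i) \<Rightarrow> if w \<in> e then h (other e) i else \<phi> p)" for p
    define Y where "Y = insert (Inl w) {Inr ({u, w}, i) | u i. u \<in> N \<and> i < r - 2}"
    have new: "\<exists>u\<in>N. e = {u, w}" if "e \<in> ?E (insert w W)" "w \<in> e" for e
    proof -
      have "card e = 2" using E that by blast
      then obtain a b where "e = {a, b}" "a \<noteq> b" by (auto simp: card_2_iff)
      then show ?thesis using that by (auto simp: N_def insert_commute)
    qed
    have XY: "?X (insert w W) = ?X W \<union> Y"
    proof
      show "?X (insert w W) \<subseteq> ?X W \<union> Y"
      proof
        fix p assume "p \<in> ?X (insert w W)"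
        then consider v where "v \<in> insert w W" "p = Inl v"
          | e i where "e \<in> ?E (insert w W)" "i < r - 2" "p = Inr (e, i)"
          by (auto simp: expansion_vertices_def)
        then show "p \<in> ?X W \<union> Y"
        proof cases
          case 1
          then show ?thesis by (auto simp: Y_def expansion_vertices_def)
        next
          case 2
          show ?thesis
          proof (cases "w \<in> e")
            case True
            then show ?thesis using new[OF 2(1)] 2 by (auto simp: Y_def)
          next
            case False
            then show ?thesis using 2 by (auto simp: expansion_vertices_def)
          qed
        qed
      qed
      show "?X W \<union> Y \<subseteq> ?X (insert w W)"
        using NW by (auto simp: Y_def expansion_vertices_def)
    qed
    have \<psi>old: "\<psi> p = \<phi> p" if "p \<in> ?X W" for p
      using that insert.hyps by (auto simp: \<psi>_def expansion_vertices_def)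
    have \<psi>w: "\<psi> (Inl w) = z" by (simp add: \<psi>_def)
    have \<psi>h: "\<psi> (Inr ({u, w}, i)) = h u i" if "u \<in> N" for u i
      using other[OF that] by (simp add: \<psi>_def)
    have injY: "inj_on \<psi> Y"
    proof (rule inj_onI)
      fix p p' assume p: "p \<in> Y" and p': "p' \<in> Y" and eq: "\<psi> p = \<psi> p'"
      have Y: "p = Inl w \<or> (\<exists>u i. p = Inr ({u, w}, i) \<and> u \<in> N \<and> i < r - 2)" if "p \<in> Y" for p
        using that unfolding Y_def by blast
      from Y[OF p] Y[OF p'] consider "p = Inl w" "p' = Inl w"
        | u i where "p = Inl w" "p' = Inr ({u, w}, i)" "u \<in> N" "i < r - 2"
        | u i where "p' = Inl w" "p = Inr ({u, w}, i)" "u \<in> N" "i < r - 2"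
        | u i u' i' where "p = Inr ({u, w}, i)" "p' = Inr ({u', w}, i')"
            "u \<in> N" "i < r - 2" "u' \<in> N" "i' < r - 2"
        by metis
      then show "p = p'"
      proof cases
        case 2
        then show ?thesis using eq \<psi>w \<psi>h[OF 2(3)] hg(2)[OF 2(3,4)] by simp
      next
        case 3
        then show ?thesis using eq \<psi>w \<psi>h[OF 3(3)] hg(2)[OF 3(3,4)] by simp
      next
        case 4
        then show ?thesis using eq \<psi>h[OF 4(3)] \<psi>h[OF 4(5)] hinj[OF 4(3-6)] by simp
      qed simp
    qed
    have YZ: "\<psi> p \<notin> Z" if "p \<in> Y" for p
      using that z \<psi>w \<psi>h hZ by (auto simp: Y_def)
    have "inj_on \<psi> (?X W \<union> Y)"
      unfolding inj_on_Un
    proof (intro conjI injY)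
      show "inj_on \<psi> (?X W)" using inj \<psi>old by (simp add: inj_on_def)
      show "\<psi> ` (?X W - Y) \<inter> \<psi> ` (Y - ?X W) = {}" 
      proof (rule equals0I)
        fix x assume "x \<in> \<psi> ` (?X W - Y) \<inter> \<psi> ` (Y - ?X W)"
        then obtain p p' where "p \<in> ?X W" "x = \<psi> p" "p' \<in> Y" "x = \<psi> p'" by blast
        then show False using YZ[of p'] ZX[of p] \<psi>old[of p] by simp
      qed
    qed
    moreover have "\<psi> ` (?X W \<union> Y) \<subseteq> {..<n}"
    proof -
      have "\<psi> p < n" if "p \<in> Y" for p
      proof -
        have "z < n" using z(1) A(1)[OF WV(2)] by blast
        moreover have "h u i < n" if "u \<in> N" "i < r - 2" for u i
          using hg(1)[OF that] g(1)[OF that(1)] H by (auto simp: linear_uniform_hg_def)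
        ultimately show ?thesis using that \<psi>w \<psi>h by (auto simp: Y_def)
      qed
      then show ?thesis using im \<psi>old by auto
    qed
    moreover have "\<psi> ` f \<in> EH" if "f \<in> expansion_edges r (?E (insert w W))" for f
    proof -
      obtain e where e: "e \<in> ?E (insert w W)" and f: "f = Inl ` e \<union> {Inr (e, i) | i. i < r - 2}"
        using \<open>f \<in> _\<close> by (auto simp: expansion_edges_def)
      show ?thesis
      proof (cases "w \<in> e")
        case True
        then obtain u where u: "u \<in> N" "e = {u, w}" using new[OF e] by blast
        have "f = {Inl u, Inl w} \<union> (\<lambda>i. Inr ({u, w}, i)) ` {..<r - 2}" using f u by auto
        then have "\<psi> ` f = {\<phi> (Inl u), z} \<union> h u ` {..<r - 2}"
          using \<psi>w \<psi>h[OF u(1)] \<psi>old[OF InlX[OF NW(1)[OF u(1)]]]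
          by (simp add: image_Un image_image)
        also have "\<dots> = g u" using bij_betw_imp_surj_on[OF h[OF u(1)]] g u by auto
        finally show ?thesis using g u by simp
      next
        case False
        then have eW: "e \<in> ?E W" using e by auto
        then have "f \<in> expansion_edges r (?E W)" unfolding f expansion_edges_def by blast
        moreover have "\<psi> ` f = \<phi> ` f"
          using eW by (intro image_cong refl \<psi>old) (auto simp: f expansion_vertices_def)
        ultimately show ?thesis using ed by simp
      qed
    qed
    moreover have "\<psi> (Inl v) \<in> A (c v)" if "v \<in> insert w W" for v
      using that z \<phi>A by (auto simp: \<psi>_def)
    ultimately show ?case unfolding XY by (intro exI[of _ \<psi>] conjI ballI)
  qed
  from this[OF V order.refl] have "\<exists>\<phi>. inj_on \<phi> (?X V) \<and> \<phi> ` (?X V) \<subseteq> {..<n}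
      \<and> (\<forall>f\<in>expansion_edges r (?E V). \<phi> ` f \<in> EH)" by blast
  moreover have "?E V = E" using E by auto
  ultimately show ?thesis by (simp add: contains_copy_def)
qed

section \<open>The upper bound\<close>

text \<open>Extends two elements of different parts to a full transversal. Transversals are cliques,
  so any two parts are completely joined.\<close>

lemma list_all2_nth_update_choice:
  assumes ne: "\<And>i. i < length As \<Longrightarrow> As ! i \<noteq> {}"
    and ij: "i < length As" "j < length As" "i \<noteq> j" and xy: "x \<in> As ! i" "y \<in> As ! j"
  obtains xs where "list_all2 (\<in>) xs As" "xs ! i = x" "xs ! j = y"
proof -
  define xs where "xs = (map (\<lambda>A. SOME a. a \<in> A) As)[i := x, j := y]"
  have "list_all2 (\<in>) xs As"
    unfolding list_all2_conv_all_nth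
  proof (intro conjI allI impI)
    fix l assume "l < length xs"
    then have l: "l < length As" by (simp add: xs_def)
    then show "xs ! l \<in> As ! l"
      using xy ne[OF l] ij by (auto simp: xs_def nth_list_update some_in_eq)
  qed (simp add: xs_def)
  moreover have "xs ! i = x" "xs ! j = y" using ij by (auto simp: xs_def)
  ultimately show thesis by (rule that)
qed

lemma hg_eigenvalue_upper:
  fixes V :: "'a set" and E :: "'a set set" and \<epsilon> :: real
  assumes r: "2 \<le> r" and k: "2 \<le> k"
    and V: "finite V" and E: "\<forall>e\<in>E. e \<subseteq> V \<and> card e = 2"
    and cV: "c ` V \<subseteq> {..<k}" and c: "\<forall>e\<in>E. \<forall>u\<in>e. \<forall>v\<in>e. u \<noteq> v \<longrightarrow> c u \<noteq> c v"
    and \<epsilon>: "\<epsilon> > 0"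
  shows "\<forall>\<^sub>F n in sequentially. \<forall>EH lam. linear_uniform_hg r n EH \<longrightarrow>
     \<not> contains_copy {..<n} EH (expansion_vertices r V E) (expansion_edges r E) \<longrightarrow>
     hg_eigenvalue r n EH lam \<longrightarrow>
     cmod lam \<le> (1 / (real r - 1) * (1 - 1 / (real k - 1)) + \<epsilon>) * real n"
proof -
  define q where "q = k - 1"
  have q: "q \<ge> 1" "k = Suc q" "real k - 1 = real q" using k by (auto simp: q_def)
  \<comment> \<open>The shadow sees \<open>(r - 1) * cmod lam\<close>, so the slack is scaled by the
    same factor.\<close>
  define \<epsilon>' where "\<epsilon>' = (real r - 1) * \<epsilon>"
  have \<epsilon>': "\<epsilon>' > 0" using r \<epsilon> by (simp add: \<epsilon>'_def)
  define K where "K = card (expansion_vertices r V E)"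
  define t where "t = Suc (K + K\<^sup>2 * r)"
  have "\<epsilon>' ^ q > 0" using \<epsilon>' by simp
  from complete_partite_blowup[OF this, of k t]
  obtain \<eta> where \<eta>: "\<eta> > 0" and blow: "\<And>U w (P :: nat list \<Rightarrow> bool). weighting U w \<Longrightarrow>
     \<forall>x\<in>U. w x \<le> \<eta> \<Longrightarrow> \<epsilon>' ^ q \<le> avg U w k (\<lambda>xs. of_bool (P xs)) \<Longrightarrow>
     \<exists>As. length As = k \<and> (\<forall>A\<in>set As. A \<subseteq> U \<and> card A = t) \<and>
        (\<forall>xs. list_all2 (\<in>) xs As \<longrightarrow> P xs)" by metis
  \<comment> \<open>A violating eigenvalue has \<open>\<mu> > \<epsilon>' * n\<close>, so this makes
    every atom, being at most \<open>1 / \<mu>\<close>, no larger than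
    \<open>\<eta>\<close>.\<close>
  have "\<forall>\<^sub>F n in sequentially. 1 / (\<epsilon>' * \<eta>) < real n"
    using filterlim_real_sequentially by (rule filterlim_at_top_dense[THEN iffD1, rule_format])
  then show ?thesis
  proof (rule eventually_mono, intro allI impI)
    fix n EH lam
    assume n: "1 / (\<epsilon>' * \<eta>) < real n" and H: "linear_uniform_hg r n EH"
      and free: "\<not> contains_copy {..<n} EH (expansion_vertices r V E) (expansion_edges r E)"
      and ev: "hg_eigenvalue r n EH lam"
    have n0: "real n > 0"
    proof -
      have "0 < 1 / (\<epsilon>' * \<eta>)" using \<epsilon>' \<eta> by simp
      then show ?thesis using n by linarith
    qed
    show "cmod lam \<le> (1 / (real r - 1) * (1 - 1 / (real k - 1)) + \<epsilon>) * real n"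
    proof (rule ccontr)
      assume neg: "\<not> ?thesis"
      define \<mu> where "\<mu> = real (r - 1) * cmod lam"
      have r1: "real (r - 1) = real r - 1" "real r - 1 > 0" using r by auto
      have "(1 - 1 / real q + \<epsilon>') * real n
          = (real r - 1) * ((1 / (real r - 1) * (1 - 1 / real q) + \<epsilon>) * real n)"
        using r1 by (simp add: \<epsilon>'_def field_simps)
      also have "\<dots> < (real r - 1) * cmod lam"
        using neg r1 q by (intro mult_strict_left_mono) auto
      finally have \<mu>: "(1 - 1 / real q + \<epsilon>') * real n < \<mu>" by (simp only: \<mu>_def r1)
      have "1 / real q \<le> 1" using q by simp
      then have "\<epsilon>' * real n \<le> (1 - 1 / real q + \<epsilon>') * real n"
        using n0 by (intro mult_right_mono) auto
      then have \<mu>\<epsilon>: "\<epsilon>' * real n < \<mu>" using \<mu> by linarith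
      have pos: "0 < \<epsilon>' * real n" using \<epsilon>' n0 by simp
      have lam0: "lam \<noteq> 0" using \<mu>\<epsilon> pos by (auto simp: \<mu>_def)
      obtain w where W: "weighting {..<n} w" and wle: "\<And>i. i < n \<Longrightarrow> w i \<le> 1 / \<mu>"
        and dens: "\<mu> / real n \<le> (\<Sum>i<n. \<Sum>j<n. w i * w j * of_bool (shadow EH i j))"
        by (rule hg_eigenvalue_weighting[OF H r ev lam0, folded \<mu>_def]) (rule that)
      interpret weighting "{..<n}" w by (rule W)
      have "1 / \<mu> \<le> 1 / (\<epsilon>' * real n)" using pos \<mu>\<epsilon> by (intro divide_left_mono) auto
      also have "\<dots> \<le> \<eta>" using n n0 \<epsilon>' \<eta> by (simp add: field_simps)
      finally have w\<eta>: "\<forall>i\<in>{..<n}. w i \<le> \<eta>" using wle by fastforce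
      have "1 - 1 / real q + \<epsilon>' \<le> \<mu> / real n" using \<mu> n0 by (simp add: field_simps)
      also note dens
      finally have "\<epsilon>' ^ q \<le> clique_density (shadow EH) (Suc q)"
        by (rule clique_density_ge_power[OF symp_shadow \<epsilon>' _ order.refl])
      then have "\<epsilon>' ^ q \<le> avg {..<n} w k (\<lambda>xs. of_bool (clique (shadow EH) xs))"
        by (simp only: clique_density_def q)
      from blow[OF W w\<eta> this] obtain As where As: "length As = k"
        "\<And>A. A \<in> set As \<Longrightarrow> A \<subseteq> {..<n} \<and> card A = t"
        "\<And>xs. list_all2 (\<in>) xs As \<Longrightarrow> clique (shadow EH) xs" by blast
      have As_nth: "As ! i \<subseteq> {..<n}" "card (As ! i) = t" if "i < k" for i
        using As(2)[of "As ! i"] As(1) that by auto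
      have As_ne: "As ! i \<noteq> {}" if "i < length As" for i
        using As_nth(2)[of i] that As(1) by (auto simp: t_def)
      have ck: "c v < k" if "v \<in> V" for v using cV that by auto
      have "contains_copy {..<n} EH (expansion_vertices r V E) (expansion_edges r E)"
      proof (rule contains_expansion_greedy[OF H r V E c K_def, of "\<lambda>i. As ! i"])
        fix u v x y assume uv: "u \<in> V" "v \<in> V" "c u \<noteq> c v" and xy: "x \<in> As ! c u" "y \<in> As ! c v"
        obtain xs where xs: "list_all2 (\<in>) xs As" "xs ! c u = x" "xs ! c v = y"
          by (rule list_all2_nth_update_choice[OF As_ne _ _ uv(3) xy])
            (simp_all add: As(1) ck uv)
        have len: "length xs = k" using list_all2_lengthD[OF xs(1)] As(1) by simp
        have cl: "clique (shadow EH) xs" by (rule As(3)[OF xs(1)])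
        show "shadow EH x y"
        proof (cases "c u < c v")
          case True
          then show ?thesis using clique_nth[OF cl True] len ck[OF uv(2)] xs by simp
        next
          case False
          then have "c v < c u" using uv by simp
          then have "shadow EH y x" using clique_nth[OF cl, of "c v" "c u"] len ck[OF uv(1)] xs by simp
          then show ?thesis by (rule sympD[OF symp_shadow])
        qed
      next
        fix v assume v: "v \<in> V"
        show "As ! c v \<subseteq> {..<n}" by (rule As_nth(1)[OF ck[OF v]])
        show "K + K\<^sup>2 * r < card (As ! c v)" using As_nth(2)[OF ck[OF v]] by (simp add: t_def)
      qed
      then show False using free by contradiction
    qed
  qed
qed

section \<open>The lower bound\<close>

text \<open>In a copy of the expansion, two adjacent core vertices lie in a common edge and hence in
  different parts. The parts would therefore colour the graph properly with \<open>q\<close>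
  colours.\<close>

lemma partite_hypergraph_spectral_lower:
  fixes U :: "'b set" and V :: "'a set"
  assumes U: "finite U" "U \<noteq> {}" "card U \<le> n" and r: "2 \<le> r"
    and Es: "\<And>f. f \<in> Es \<Longrightarrow> f \<subseteq> U \<and> card f = r"
    and lin: "\<And>f g u v. f \<in> Es \<Longrightarrow> g \<in> Es \<Longrightarrow> {u, v} \<subseteq> f \<inter> g \<Longrightarrow> u \<noteq> v \<Longrightarrow> f = g"
    and deg: "\<And>u. u \<in> U \<Longrightarrow> card {f \<in> Es. u \<in> f} = d"
    and col: "col ` U \<subseteq> {..<q}" "\<And>f. f \<in> Es \<Longrightarrow> inj_on col f"
    and E: "\<forall>e\<in>E. e \<subseteq> V" and chrom: "q < chromatic_number V E"
  obtains EH where "linear_uniform_hg r n EH"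
    "\<not> contains_copy {..<n} EH (expansion_vertices r V E) (expansion_edges r E)"
    "real d \<le> hg_spectral_radius r n EH"
proof -
  have "\<exists>\<phi>. \<phi> ` U \<subseteq> {..<n} \<and> inj_on \<phi> U"
    using card_le_inj[of U "{..<n}"] U by auto
  then obtain \<phi> where \<phi>: "\<phi> ` U \<subseteq> {..<n}" "inj_on \<phi> U" by blast
  define EH where "EH = (`) \<phi> ` Es"
  have subU: "f \<subseteq> U" if "f \<in> Es" for f using Es that by blast
  have H: "linear_uniform_hg r n EH"
    unfolding linear_uniform_hg_def
  proof (intro conjI ballI impI)
    fix e assume "e \<in> EH"
    then obtain f where f: "f \<in> Es" "e = \<phi> ` f" by (auto simp: EH_def)
    show "e \<subseteq> {..<n}" using f subU \<phi> by blast
    show "card e = r" using f Es card_image[OF inj_on_subset[OF \<phi>(2) subU]] by simp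
  next
    fix e e' assume "e \<in> EH" "e' \<in> EH" and ne: "e \<noteq> e'"
    then obtain f f' where f: "f \<in> Es" "e = \<phi> ` f" "f' \<in> Es" "e' = \<phi> ` f'"
      by (auto simp: EH_def)
    have int: "e \<inter> e' = \<phi> ` (f \<inter> f')"
      using f subU inj_on_image_Int[OF \<phi>(2), of f f'] by simp
    have fin: "finite (f \<inter> f')" using f subU U finite_subset by (metis finite_Int)
    have "card (e \<inter> e') \<le> card (f \<inter> f')" unfolding int by (rule card_image_le[OF fin])
    also have "\<dots> \<le> Suc 0"
      unfolding card_le_Suc0_iff_eq[OF fin] using lin[of f f'] f ne by blast
    finally show "card (e \<inter> e') \<le> 1" by simp
  qed
  have free: "\<not> contains_copy {..<n} EH (expansion_vertices r V E) (expansion_edges r E)"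
  proof
    assume "contains_copy {..<n} EH (expansion_vertices r V E) (expansion_edges r E)"
    then obtain \<psi> where \<psi>: "inj_on \<psi> (expansion_vertices r V E)"
      "\<And>f. f \<in> expansion_edges r E \<Longrightarrow> \<psi> ` f \<in> EH" by (auto simp: contains_copy_def)
    obtain u0 where "u0 \<in> U" using U by blast
    then have q: "0 < q" using col by auto
    \<comment> \<open>A vertex of \<open>V\<close> in no edge may be mapped outside the parts; it
      takes the default colour 0, which is admissible because \<open>q > 0\<close>.\<close>
    define c where "c v = (if \<psi> (Inl v) \<in> \<phi> ` U then col (inv_into U \<phi> (\<psi> (Inl v))) else 0)" for v
    have "c ` V \<subseteq> {..<q}"
      using q col(1) inv_into_into[of _ \<phi> U] by (auto simp: c_def)
    moreover have "c u \<noteq> c v" if e: "e \<in> E" "u \<in> e" "v \<in> e" "u \<noteq> v" for e u v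
    proof -
      have "\<psi> ` (Inl ` e \<union> {Inr (e, i) | i. i < r - 2}) \<in> EH"
        using \<psi>(2) e(1) by (auto simp: expansion_edges_def)
      then obtain f where f: "f \<in> Es" "\<psi> ` (Inl ` e \<union> {Inr (e, i) | i. i < r - 2}) = \<phi> ` f"
        by (auto simp: EH_def)
      have mem: "\<psi> (Inl x) \<in> \<phi> ` f" if "x \<in> e" for x
        unfolding f(2)[symmetric] using that by blast
      have inv: "inv_into U \<phi> (\<psi> (Inl x)) \<in> f" "\<phi> (inv_into U \<phi> (\<psi> (Inl x))) = \<psi> (Inl x)"
        if "x \<in> e" for x
      proof -
        obtain y where y: "y \<in> f" "\<psi> (Inl x) = \<phi> y" using mem[OF \<open>x \<in> e\<close>] by blast
        then have "inv_into U \<phi> (\<psi> (Inl x)) = y"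
          using inv_into_f_f[OF \<phi>(2)] subU[OF f(1)] by auto
        then show "inv_into U \<phi> (\<psi> (Inl x)) \<in> f" "\<phi> (inv_into U \<phi> (\<psi> (Inl x))) = \<psi> (Inl x)"
          using y by auto
      qed
      have cc: "c x = col (inv_into U \<phi> (\<psi> (Inl x)))" if "x \<in> e" for x
        using mem[OF that] subU[OF f(1)] by (auto simp: c_def)
      have "Inl u \<in> expansion_vertices r V E" "Inl v \<in> expansion_vertices r V E"
        using e E by (auto simp: expansion_vertices_def)
      then have "\<psi> (Inl u) \<noteq> \<psi> (Inl v)" using \<psi>(1) e(4) by (auto dest: inj_onD)
      then have "inv_into U \<phi> (\<psi> (Inl u)) \<noteq> inv_into U \<phi> (\<psi> (Inl v))"
        using inv(2)[OF e(2)] inv(2)[OF e(3)] by auto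
      then show ?thesis
        unfolding cc[OF e(2)] cc[OF e(3)]
        using inj_onD[OF col(2)[OF f(1)] _ inv(1)[OF e(2)] inv(1)[OF e(3)]] by blast
    qed
    ultimately have "chromatic_number V E \<le> q"
      unfolding chromatic_number_def by (intro Least_le exI[of _ c] conjI) auto
    then show False using chrom by simp
  qed
  have "real d \<le> hg_spectral_radius r n EH"
  proof (rule hg_spectral_radius_ge_degree[OF H r \<phi>(1)])
    show "\<phi> ` U \<noteq> {}" using U by simp
    show "e \<subseteq> \<phi> ` U" if "e \<in> EH" for e using that subU by (auto simp: EH_def)
    fix i assume "i \<in> \<phi> ` U"
    then obtain u where u: "u \<in> U" "i = \<phi> u" by blast
    have "i \<in> \<phi> ` f \<longleftrightarrow> u \<in> f" if "f \<in> Es" for f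
      unfolding u(2) by (rule inj_on_image_mem_iff[OF \<phi>(2) u(1) subU[OF that]])
    then have "{e \<in> EH. i \<in> e} = (`) \<phi> ` {f \<in> Es. u \<in> f}"
      unfolding EH_def by blast
    moreover have "inj_on ((`) \<phi>) {f \<in> Es. u \<in> f}"
      by (rule inj_on_subset[OF inj_on_image_Pow[OF \<phi>(2)]]) (use subU in auto)
    ultimately show "card {e \<in> EH. i \<in> e} = d" using deg[OF u(1)] by (simp add: card_image)
  qed
  with H free show thesis by (rule that)
qed

text \<open>All coordinates but one are free, and the residue of the sum then determines the last
  one.\<close>

lemma card_funcsetE_sum_mod:
  fixes P :: "'a set" and m w :: nat
  assumes P: "finite P" "P \<noteq> {}" and w: "w \<le> m" and m: "0 < m"
  shows "card {b \<in> P \<rightarrow>\<^sub>E {0..<int m}. (\<Sum>e\<in>P. b e) mod int m < int w} = w * m ^ (card P - 1)"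
proof -
  let ?B = "{b \<in> P \<rightarrow>\<^sub>E {0..<int m}. (\<Sum>e\<in>P. b e) mod int m < int w}"
  obtain e0 where e0: "e0 \<in> P" using P by blast
  define Q where "Q = P - {e0}"
  have PQ: "P = insert e0 Q" "e0 \<notin> Q" "finite Q" using e0 P by (auto simp: Q_def)
  have sumP: "(\<Sum>e\<in>P. b e) = b e0 + (\<Sum>e\<in>Q. b e)" for b :: "'a \<Rightarrow> int" using PQ by simp
  define F where "F = (\<lambda>b :: 'a \<Rightarrow> int. ((\<Sum>e\<in>P. b e) mod int m, restrict b Q))"
  define G where "G = (\<lambda>(s :: int, g :: 'a \<Rightarrow> int). g(e0 := (s - (\<Sum>e\<in>Q. g e)) mod int m))"
  have "bij_betw F ?B ({0..<int w} \<times> (Q \<rightarrow>\<^sub>E {0..<int m}))"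
  proof (rule bij_betw_byWitness[of _ G])
    show "\<forall>b\<in>?B. G (F b) = b"
    proof
      fix b assume b: "b \<in> ?B"
      have "((\<Sum>e\<in>P. b e) mod int m - (\<Sum>e\<in>Q. b e)) mod int m = b e0 mod int m"
        by (simp add: sumP mod_diff_left_eq)
      also have "\<dots> = b e0" using b e0 by (auto simp: PiE_iff)
      finally have "G (F b) = (restrict b Q)(e0 := b e0)" by (simp add: G_def F_def)
      also have "\<dots> = b"
      proof
        fix e show "((restrict b Q)(e0 := b e0)) e = b e"
          using b PQ(1) by (auto simp: PiE_iff extensional_def)
      qed
      finally show "G (F b) = b" .
    qed
    show "\<forall>p\<in>{0..<int w} \<times> (Q \<rightarrow>\<^sub>E {0..<int m}). F (G p) = p"
    proof
      fix p assume "p \<in> {0..<int w} \<times> (Q \<rightarrow>\<^sub>E {0..<int m})"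
      then obtain s g where p: "p = (s, g)" "0 \<le> s" "s < int w" "g \<in> Q \<rightarrow>\<^sub>E {0..<int m}" by auto
      have "(\<Sum>e\<in>Q. (G p) e) = (\<Sum>e\<in>Q. g e)"
        using PQ(2) by (intro sum.cong) (auto simp: G_def p)
      then have "(\<Sum>e\<in>P. (G p) e) mod int m = s mod int m"
        by (simp add: sumP) (simp add: G_def p mod_add_left_eq)
      also have "\<dots> = s" using p w by simp
      finally have "(\<Sum>e\<in>P. (G p) e) mod int m = s" .
      moreover have "restrict (G p) Q = g"
        using p(4) PQ(2) by (auto simp: G_def p restrict_def fun_eq_iff PiE_iff extensional_def)
      ultimately show "F (G p) = p" by (simp add: F_def p)
    qed
    show "F ` ?B \<subseteq> {0..<int w} \<times> (Q \<rightarrow>\<^sub>E {0..<int m})"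
    proof
      fix p assume "p \<in> F ` ?B"
      then obtain b where b: "p = F b" "b \<in> ?B" by blast
      then have "restrict b Q \<in> Q \<rightarrow>\<^sub>E {0..<int m}" using PQ(1) by (auto simp: PiE_iff)
      then show "p \<in> {0..<int w} \<times> (Q \<rightarrow>\<^sub>E {0..<int m})" using b m by (simp add: F_def)
    qed
    show "G ` ({0..<int w} \<times> (Q \<rightarrow>\<^sub>E {0..<int m})) \<subseteq> ?B"
    proof
      fix b assume "b \<in> G ` ({0..<int w} \<times> (Q \<rightarrow>\<^sub>E {0..<int m}))"
      then obtain s g where p: "b = G (s, g)" "0 \<le> s" "s < int w" "g \<in> Q \<rightarrow>\<^sub>E {0..<int m}" by auto
      have "(\<Sum>e\<in>Q. b e) = (\<Sum>e\<in>Q. g e)"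
        using PQ(2) by (intro sum.cong) (auto simp: G_def p)
      then have "(\<Sum>e\<in>P. b e) mod int m = s mod int m"
        by (simp add: sumP) (simp add: G_def p mod_add_left_eq)
      also have "\<dots> = s" using p w by simp
      finally show "b \<in> ?B"
        using p m PQ(1) by (auto simp: G_def PiE_iff extensional_def)
    qed
  qed
  then have "card ?B = card ({0..<int w} \<times> (Q \<rightarrow>\<^sub>E {0..<int m}))" by (rule bij_betw_same_card)
  also have "\<dots> = w * m ^ (card P - 1)"
  proof -
    have "card Q = card P - 1" using e0 P by (simp add: Q_def)
    then show ?thesis using PQ(3) by (simp add: card_cartesian_product card_funcsetE)
  qed
  finally show ?thesis .
qed

section \<open>The packing over the integers modulo \<open>m\<close>\<close>

definition pairs_below :: "nat \<Rightarrow> (nat \<times> nat) set" where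
  "pairs_below q = {(a, b). a < b \<and> b < q}"

definition slope :: "nat \<Rightarrow> nat \<times> nat \<Rightarrow> nat" where
  "slope i e = (if i = snd e then fst e else i)"

lemma finite_pairs_below: "finite (pairs_below q)"
  by (rule finite_subset[of _ "{..<q} \<times> {..<q}"]) (auto simp: pairs_below_def)

text \<open>For fixed \<open>e\<close> only the two parts of \<open>e\<close> share a slope.
  Elsewhere the difference is nonzero and below \<open>q\<close> in absolute value, hence a unit by
  \<open>cop\<close>.\<close>

lemma slope_neq:
  assumes "i < j" "j < q" "e \<in> pairs_below q" "e \<noteq> (i, j)"
  shows "slope i e \<noteq> slope j e" "slope i e < q" "slope j e < q"
  using assms by (cases e; auto simp: slope_def pairs_below_def)+

text \<open>
  The vertices are \<open>(i, x)\<close> with a part \<open>i < q\<close> and a vector \<open>x\<close> over the integers modulo \<open>m\<close> that has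
  one coordinate for each pair of parts. An edge is given by an \<open>r\<close>-set \<open>R\<close> of parts, a base point \<open>a\<close>
  and a direction \<open>b\<close>; its vertex in part \<open>i\<close> has the coordinates \<open>a e + offset i R b e\<close>.
  For vertices in parts \<open>i < j\<close> the difference of the coordinates at \<open>e = (i, j)\<close> is
  \<open>total_of b + w * idx e R\<close>, because both slopes agree there; as \<open>total_of b < w\<close> this reveals \<open>R\<close> and
  \<open>total_of b\<close>. At any other pair \<open>e\<close> the slopes differ by a unit, which reveals \<open>b e\<close>, and the sum
  \<open>total_of b\<close> then gives the missing coordinate of \<open>b\<close>. So two vertices determine the edge.
\<close>
locale partite_packing =
  fixes q r m w N :: nat and idx :: "nat \<times> nat \<Rightarrow> nat set \<Rightarrow> nat"
  assumes r: "2 \<le> r" "r \<le> q" and m: "1 < m" and w: "w * N \<le> m" "0 < N"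
    and cop: "\<And>d. 0 < d \<Longrightarrow> d < q \<Longrightarrow> coprime d m"
    and idx: "\<And>i j. i < j \<Longrightarrow> j < q \<Longrightarrow>
        inj_on (idx (i, j)) {R. R \<subseteq> {..<q} \<and> card R = r \<and> i \<in> R \<and> j \<in> R}"
      "\<And>i j R. i < j \<Longrightarrow> j < q \<Longrightarrow> R \<subseteq> {..<q} \<Longrightarrow> card R = r \<Longrightarrow> i \<in> R \<Longrightarrow> j \<in> R \<Longrightarrow>
        idx (i, j) R < N"
begin

abbreviation P where "P \<equiv> pairs_below q"
abbreviation X where "X \<equiv> P \<rightarrow>\<^sub>E {0..<int m}"

definition total_of :: "(nat \<times> nat \<Rightarrow> int) \<Rightarrow> int" where
  "total_of b = (\<Sum>e\<in>P. b e) mod int m"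

definition blocks :: "nat set set" where
  "blocks = {R. R \<subseteq> {..<q} \<and> card R = r}"

text \<open>The restriction keeps a fraction \<open>w / m\<close>, about \<open>1 / N\<close>, of
  all vectors. This pays for the \<open>N\<close> blocks that share each pair of parts.\<close>

definition directions :: "(nat \<times> nat \<Rightarrow> int) set" where
  "directions = {b \<in> X. total_of b < int w}"

definition offset :: "nat \<Rightarrow> nat set \<Rightarrow> (nat \<times> nat \<Rightarrow> int) \<Rightarrow> nat \<times> nat \<Rightarrow> int" where
  "offset i R b e = int (slope i e) * b e
     + (if i = snd e then total_of b + int w * int (idx e R) else 0)"

definition coords :: "nat \<Rightarrow> nat set \<times> (nat \<times> nat \<Rightarrow> int) \<times> (nat \<times> nat \<Rightarrow> int) \<Rightarrow> nat \<times> nat \<Rightarrow> int" where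
  "coords i = (\<lambda>(R, a, b). \<lambda>e\<in>P. (a e + offset i R b e) mod int m)"

definition edge :: "nat set \<times> (nat \<times> nat \<Rightarrow> int) \<times> (nat \<times> nat \<Rightarrow> int) \<Rightarrow> (nat \<times> (nat \<times> nat \<Rightarrow> int)) set" where
  "edge p = (\<lambda>i. (i, coords i p)) ` fst p"

definition params :: "(nat set \<times> (nat \<times> nat \<Rightarrow> int) \<times> (nat \<times> nat \<Rightarrow> int)) set" where
  "params = blocks \<times> X \<times> directions"

lemma cong_imp_eq:
  "[x = y] (mod int m) \<Longrightarrow> x \<in> {0..<int m} \<Longrightarrow> y \<in> {0..<int m} \<Longrightarrow> x = y"
  by (simp add: cong_def)

lemma pair_determines_params:
  assumes ij: "i < j" "j < q"
    and p: "(R, a, b) \<in> params" "i \<in> R" "j \<in> R" and p': "(R', a', b') \<in> params" "i \<in> R'" "j \<in> R'"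
    and ci: "coords i (R, a, b) = coords i (R', a', b')"
    and cj: "coords j (R, a, b) = coords j (R', a', b')"
  shows "(R, a, b) = (R', a', b')"
proof -
  have ci': "[a e + offset i R b e = a' e + offset i R' b' e] (mod int m)" if "e \<in> P" for e
    using fun_cong[OF ci, of e] that by (simp add: coords_def cong_def)
  have cj': "[a e + offset j R b e = a' e + offset j R' b' e] (mod int m)" if "e \<in> P" for e
    using fun_cong[OF cj, of e] that by (simp add: coords_def cong_def)
  have diff: "[offset j R b e - offset i R b e = offset j R' b' e - offset i R' b' e] (mod int m)"
    if "e \<in> P" for e
    using cong_diff[OF cj'[OF that] ci'[OF that]] by simp
  have Rs: "R \<subseteq> {..<q}" "card R = r" "R' \<subseteq> {..<q}" "card R' = r"
    and X: "a \<in> X" "a' \<in> X" "b \<in> X" "b' \<in> X"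
    and tot: "total_of b < int w" "total_of b' < int w"
    using p p' by (auto simp: params_def blocks_def directions_def)
  have tot0: "0 \<le> total_of b" "0 \<le> total_of b'" using m by (auto simp: total_of_def)
  have ijP: "(i, j) \<in> P" using ij by (simp add: pairs_below_def)
  have eqij: "offset j R b (i, j) - offset i R b (i, j) = total_of b + int w * int (idx (i, j) R)" for R b
    using ij by (simp add: offset_def slope_def)
  have lt: "total_of b + int w * int (idx (i, j) R) < int m"
    if "total_of b < int w" "idx (i, j) R < N" for R b
  proof -
    have "total_of b + int w * int (idx (i, j) R) < int w + int w * int (idx (i, j) R)"
      using that by simp
    also have "\<dots> = int (w * Suc (idx (i, j) R))" by (simp add: algebra_simps)
    also have "\<dots> \<le> int (w * N)" using that by (intro zle_int[THEN iffD2] mult_le_mono2) simp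
    also have "\<dots> \<le> int m" using w(1) by linarith
    finally show ?thesis .
  qed
  have idxN: "idx (i, j) R < N" "idx (i, j) R' < N"
    using idx(2)[OF ij Rs(1,2) p(2,3)] idx(2)[OF ij Rs(3,4) p'(2,3)] by simp_all
  \<comment> \<open>Both sides lie below \<open>m\<close> because \<open>w * N \<le> m\<close>, so
    the congruence is an equality; reduction modulo \<open>w\<close> then separates the total from
    the index.\<close>
  have eq: "total_of b + int w * int (idx (i, j) R) = total_of b' + int w * int (idx (i, j) R')"
    by (rule cong_imp_eq[OF diff[OF ijP, unfolded eqij]])
      (use lt[OF tot(1) idxN(1)] lt[OF tot(2) idxN(2)] tot0 in simp_all)
  have "total_of b = (total_of b + int w * int (idx (i, j) R)) mod int w"
    using tot(1) tot0(1) by simp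
  also have "\<dots> = total_of b'" unfolding eq using tot(2) tot0(2) by simp
  finally have tt: "total_of b = total_of b'" .
  have "int w > 0" using tot(1) tot0(1) by linarith
  then have ii: "idx (i, j) R = idx (i, j) R'" using eq tt by simp
  have RR: "R = R'"
    using inj_onD[OF idx(1)[OF ij], of R R'] ii Rs p p' by simp
  have be: "b e = b' e" if e: "e \<in> P" "e \<noteq> (i, j)" for e
  proof -
    define D where "D = int (slope j e) - int (slope i e)"
    have "[D * b e = D * b' e] (mod int m)"
    proof -
      \<comment> \<open>Once \<open>R\<close> and the total are known to agree, everything except
        the slope term is the same on both sides.\<close>
      define t where "t = (if j = snd e then total_of b' + int w * int (idx e R') else 0)
        - (if i = snd e then total_of b' + int w * int (idx e R') else 0)"
      have "offset j R b e - offset i R b e = D * b e + t"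
        unfolding offset_def RR tt t_def D_def by (simp add: left_diff_distrib)
      moreover have "offset j R' b' e - offset i R' b' e = D * b' e + t"
        unfolding offset_def t_def D_def by (simp add: left_diff_distrib)
      ultimately have "[D * b e + t = D * b' e + t] (mod int m)"
        using diff[OF e(1)] by simp
      then show ?thesis by (simp add: cong_add_rcancel)
    qed
    moreover have "coprime D (int m)"
    proof -
      have "coprime (nat \<bar>D\<bar>) m"
        using slope_neq[OF ij e] by (intro cop) (auto simp: D_def)
      then have "coprime (int (nat \<bar>D\<bar>)) (int m)" by (simp only: coprime_int_iff)
      then show ?thesis by simp
    qed
    ultimately have "[b e = b' e] (mod int m)" by (simp add: cong_mult_lcancel)
    moreover have "b e \<in> {0..<int m}" "b' e \<in> {0..<int m}" using X e by (auto simp: PiE_iff)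
    ultimately show ?thesis by (rule cong_imp_eq)
  qed
  have bij: "b (i, j) = b' (i, j)"
  proof -
    have split: "(\<Sum>e\<in>P. g e) = g (i, j) + (\<Sum>e\<in>P - {(i, j)}. g e)" for g :: "nat \<times> nat \<Rightarrow> int"
      by (rule sum.remove[OF finite_pairs_below ijP])
    have "(\<Sum>e\<in>P - {(i, j)}. b e) = (\<Sum>e\<in>P - {(i, j)}. b' e)"
      by (rule sum.cong) (use be in auto)
    then have "[b (i, j) = b' (i, j)] (mod int m)"
      using tt by (simp add: total_of_def split flip: cong_def) (simp add: cong_add_rcancel)
    moreover have "b (i, j) \<in> {0..<int m}" "b' (i, j) \<in> {0..<int m}" using X ijP by (auto simp: PiE_iff)
    ultimately show ?thesis by (rule cong_imp_eq)
  qed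
  have bb: "b = b'"
    by (rule PiE_ext[OF X(3,4)]) (metis be bij)
  have aa: "a = a'"
  proof (rule PiE_ext[OF X(1,2)])
    fix e assume e: "e \<in> P"
    have "[a e = a' e] (mod int m)" using ci'[OF e] by (simp add: RR bb cong_add_rcancel)
    moreover have "a e \<in> {0..<int m}" "a' e \<in> {0..<int m}" using X e by (auto simp: PiE_iff)
    ultimately show "a e = a' e" by (rule cong_imp_eq)
  qed
  show ?thesis using RR aa bb by simp
qed

lemma edges_linear:
  assumes p: "p \<in> params" "p' \<in> params" and uv: "{u, v} \<subseteq> edge p \<inter> edge p'" "u \<noteq> v"
  shows "p = p'"
proof -
  obtain R a b where p1: "p = (R, a, b)" by (rule prod_cases3)
  obtain R' a' b' where p2: "p' = (R', a', b')" by (rule prod_cases3)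
  note pe = p1 p2
  obtain i x where u: "u = (i, x)" by (rule prod.exhaust)
  obtain j y where v: "v = (j, y)" by (rule prod.exhaust)
  from u v have i: "i \<in> R" "i \<in> R'" "x = coords i p" "x = coords i p'"
    and j: "j \<in> R" "j \<in> R'" "y = coords j p" "y = coords j p'" and "i \<noteq> j"
    using uv by (auto simp: edge_def pe)
  have lt: "i < q" "j < q" using i j p by (auto simp: pe params_def blocks_def)
  show ?thesis
  proof (cases "i < j")
    case True
    show ?thesis unfolding pe
      by (rule pair_determines_params[OF True lt(2)]) (use p i j in \<open>auto simp: pe\<close>)
  next
    case False
    then have "j < i" using \<open>i \<noteq> j\<close> by simp
    then show ?thesis unfolding pe
      by (rule pair_determines_params[OF _ lt(1)]) (use p i j in \<open>auto simp: pe\<close>)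
  qed
qed

lemma card_edge: "p \<in> params \<Longrightarrow> card (edge p) = r"
  by (auto simp: edge_def params_def blocks_def card_image inj_on_def)

text \<open>Since \<open>r \<ge> 2\<close>, an edge has two vertices, and these already determine
  its parameters.\<close>

lemma edge_inj: "inj_on edge params"
proof (rule inj_onI)
  fix p p' assume p: "p \<in> params" "p' \<in> params" "edge p = edge p'"
  have "\<not> card (edge p) \<le> Suc 0" "finite (edge p)"
    using card_edge[OF p(1)] r by (auto intro: card_ge_0_finite)
  then obtain u v where "u \<in> edge p" "v \<in> edge p" "u \<noteq> v"
    using card_le_Suc0_iff_eq[of "edge p"] by blast
  then show "p = p'" using edges_linear[OF p(1,2), of u v] p(3) by simp
qed

text \<open>Given the vertex, \<open>R\<close> containing \<open>i\<close> and the direction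
  \<open>b\<close> are free, and the base point is recovered as \<open>x\<close> minus the
  offset.\<close>

lemma degree:
  assumes i: "i < q" and x: "x \<in> X"
  shows "card {f \<in> edge ` params. (i, x) \<in> f}
       = ((q - 1) choose (r - 1)) * (w * m ^ (card P - 1))"
proof -
  let ?S = "{p \<in> params. i \<in> fst p \<and> x = coords i p}"
  define param_of where "param_of = (\<lambda>(R, b). (R, \<lambda>e\<in>P. (x e - offset i R b e) mod int m, b))"
  have "{f \<in> edge ` params. (i, x) \<in> f} = edge ` ?S" by (auto simp: edge_def)
  then have "card {f \<in> edge ` params. (i, x) \<in> f} = card (edge ` ?S)" by simp
  also have "\<dots> = card ?S"
    by (rule card_image[OF inj_on_subset[OF edge_inj]]) auto
  also have "\<dots> = card ({R \<in> blocks. i \<in> R} \<times> directions)"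
  proof (rule bij_betw_same_card[symmetric], rule bij_betw_byWitness[of _ "\<lambda>(R, a, b). (R, b)"])
    show "\<forall>p\<in>{R \<in> blocks. i \<in> R} \<times> directions. (case param_of p of (R, a, b) \<Rightarrow> (R, b)) = p"
      by (auto simp: param_of_def)
    show "\<forall>p\<in>?S. param_of (case p of (R, a, b) \<Rightarrow> (R, b)) = p"
    proof
      fix p assume p: "p \<in> ?S"
      obtain R a b where pe: "p = (R, a, b)" by (rule prod_cases3)
      have a: "a \<in> X" using p by (simp add: pe params_def)
      have "(\<lambda>e\<in>P. (x e - offset i R b e) mod int m) = a"
      proof (rule PiE_ext[OF _ a])
        show "(\<lambda>e\<in>P. (x e - offset i R b e) mod int m) \<in> X" using m by auto
        fix e assume e: "e \<in> P"
        have "x e = (a e + offset i R b e) mod int m" using p e by (simp add: pe coords_def)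
        then have "(x e - offset i R b e) mod int m = a e mod int m" by (simp add: mod_diff_left_eq)
        also have "\<dots> = a e" using a e by (auto simp: PiE_iff)
        finally show "(\<lambda>e\<in>P. (x e - offset i R b e) mod int m) e = a e" using e by simp
      qed
      then show "param_of (case p of (R, a, b) \<Rightarrow> (R, b)) = p" by (simp add: pe param_of_def)
    qed
    show "param_of ` ({R \<in> blocks. i \<in> R} \<times> directions) \<subseteq> ?S"
    proof
      fix p assume "p \<in> param_of ` ({R \<in> blocks. i \<in> R} \<times> directions)"
      then obtain R b where Rb: "R \<in> blocks" "i \<in> R" "b \<in> directions"
        and p: "p = (R, \<lambda>e\<in>P. (x e - offset i R b e) mod int m, b)" by (auto simp: param_of_def)
      have "x = coords i p"
      proof (rule PiE_ext[OF x])
        show "coords i p \<in> X" using m by (auto simp: p coords_def)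
        fix e assume e: "e \<in> P"
        have "coords i p e = x e mod int m" using e by (simp add: p coords_def mod_add_left_eq)
        also have "\<dots> = x e" using x e by (auto simp: PiE_iff)
        finally show "x e = coords i p e" by simp
      qed
      moreover have "p \<in> params" using Rb m by (auto simp: p params_def)
      ultimately show "p \<in> ?S" using Rb by (simp add: p)
    qed
    show "(\<lambda>(R, a, b). (R, b)) ` ?S \<subseteq> {R \<in> blocks. i \<in> R} \<times> directions"
      by (auto simp: params_def)
  qed
  also have "\<dots> = card {R \<in> blocks. i \<in> R} * card directions" by (rule card_cartesian_product)
  also have "card {R \<in> blocks. i \<in> R} = (q - 1) choose (r - 1)"
  proof -
    have "bij_betw (insert i) {T. T \<subseteq> {..<q} - {i} \<and> card T = r - 1} {R \<in> blocks. i \<in> R}"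
    proof (rule bij_betw_byWitness[of _ "\<lambda>R. R - {i}"])
      show "insert i ` {T. T \<subseteq> {..<q} - {i} \<and> card T = r - 1} \<subseteq> {R \<in> blocks. i \<in> R}"
      proof
        fix R assume "R \<in> insert i ` {T. T \<subseteq> {..<q} - {i} \<and> card T = r - 1}"
        then obtain T where T: "R = insert i T" "T \<subseteq> {..<q} - {i}" "card T = r - 1" by blast
        then have "finite T" "i \<notin> T" by (auto intro: finite_subset)
        then show "R \<in> {R \<in> blocks. i \<in> R}" using T r i by (auto simp: blocks_def)
      qed
      show "(\<lambda>R. R - {i}) ` {R \<in> blocks. i \<in> R} \<subseteq> {T. T \<subseteq> {..<q} - {i} \<and> card T = r - 1}"
        by (auto simp: blocks_def)
    qed (auto simp: blocks_def)
    then have "card {R \<in> blocks. i \<in> R} = card {T. T \<subseteq> {..<q} - {i} \<and> card T = r - 1}"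
      by (rule bij_betw_same_card[symmetric])
    also have "\<dots> = (q - 1) choose (r - 1)"
      using n_subsets[of "{..<q} - {i}" "r - 1"] i by simp
    finally show ?thesis .
  qed
  also have "card directions = w * m ^ (card P - 1)"
  proof -
    have "w * 1 \<le> w * N" using w(2) by (intro mult_le_mono2) simp
    then have "w \<le> m" using w(1) by linarith
    moreover have "(0, 1) \<in> P" using r by (simp add: pairs_below_def)
    then have "P \<noteq> {}" by blast
    ultimately show ?thesis
      unfolding directions_def total_of_def
      using card_funcsetE_sum_mod[OF finite_pairs_below, of q w m] m by simp
  qed
  finally show ?thesis .
qed

end

section \<open>Numbering of the blocks, choice of the modulus, passage to all
  \<open>n\<close>\<close>

lemma card_subsets_containing_pair_le:
  assumes "i < q" "j < q" "i \<noteq> j"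
  shows "card {R. R \<subseteq> {..<q} \<and> card R = r \<and> i \<in> R \<and> j \<in> R} \<le> (q - 2) choose (r - 2)"
proof -
  let ?S = "{R. R \<subseteq> {..<q} \<and> card R = r \<and> i \<in> R \<and> j \<in> R}"
  let ?T = "{T. T \<subseteq> {..<q} - {i, j} \<and> card T = r - 2}"
  have "inj_on (\<lambda>R. R - {i, j}) ?S"
  proof (rule inj_onI)
    fix R R' assume "R \<in> ?S" "R' \<in> ?S" "R - {i, j} = R' - {i, j}"
    then show "R = R'" by blast
  qed
  moreover have "(\<lambda>R. R - {i, j}) ` ?S \<subseteq> ?T"
    using assms by (auto simp: card_Diff_subset)
  moreover have "finite ?T" by (rule finite_subset[of _ "Pow {..<q}"]) auto
  ultimately have "card ?S \<le> card ?T" by (rule card_inj_on_le)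
  also have "card ({..<q} - {i, j}) = q - 2" using assms by (simp add: card_Diff_subset)
  then have "card ?T = (q - 2) choose (r - 2)"
    using n_subsets[of "{..<q} - {i, j}" "r - 2"] by simp
  finally show ?thesis .
qed

lemma ex_pair_index:
  "\<exists>idx. \<forall>i j. i < j \<longrightarrow> j < q \<longrightarrow>
     inj_on (idx (i, j)) {R. R \<subseteq> {..<q} \<and> card R = r \<and> i \<in> R \<and> j \<in> R} \<and>
     (\<forall>R. R \<subseteq> {..<q} \<and> card R = r \<and> i \<in> R \<and> j \<in> R \<longrightarrow> idx (i, j) R < (q - 2) choose (r - 2))"
proof -
  define S where "S e = {R. R \<subseteq> {..<q} \<and> card R = r \<and> fst e \<in> R \<and> snd e \<in> R}" for e :: "nat \<times> nat"
  have "finite (S e)" for e by (rule finite_subset[of _ "Pow {..<q}"]) (auto simp: S_def)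
  then have "\<forall>e. \<exists>h. bij_betw h (S e) {0..<card (S e)}" by (intro allI ex_bij_betw_finite_nat)
  then obtain idx where idx: "\<And>e. bij_betw (idx e) (S e) {0..<card (S e)}" by metis
  show ?thesis
  proof (intro exI[of _ idx] allI impI)
    fix i j :: nat assume ij: "i < j" "j < q"
    have "card (S (i, j)) \<le> (q - 2) choose (r - 2)"
      unfolding S_def fst_conv snd_conv by (rule card_subsets_containing_pair_le) (use ij in auto)
    then have "\<forall>R\<in>S (i, j). idx (i, j) R < (q - 2) choose (r - 2)"
      using bij_betwE[OF idx[of "(i, j)"]] by fastforce
    then show "inj_on (idx (i, j)) {R. R \<subseteq> {..<q} \<and> card R = r \<and> i \<in> R \<and> j \<in> R} \<and>
     (\<forall>R. R \<subseteq> {..<q} \<and> card R = r \<and> i \<in> R \<and> j \<in> R \<longrightarrow> idx (i, j) R < (q - 2) choose (r - 2))"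
      using bij_betw_imp_inj_on[OF idx[of "(i, j)"]] by (simp add: S_def)
  qed
qed

text \<open>Every \<open>d\<close> with \<open>0 < d < q\<close> divides \<open>q!\<close>, so
  \<open>m\<close> congruent to 1 modulo \<open>q!\<close> is coprime to all possible slope
  differences. The width is the largest that allows \<open>N\<close> disjoint intervals of
  residues.\<close>

lemma spectral_lower_modulus:
  fixes V :: "'a set"
  assumes r: "2 \<le> r" "r \<le> q" and m: "m = 1 + fact q * l" "0 < l"
    and n: "q * m ^ card (pairs_below q) \<le> n"
    and E: "\<forall>e\<in>E. e \<subseteq> V" and chrom: "q < chromatic_number V E"
  obtains EH where "linear_uniform_hg r n EH"
    "\<not> contains_copy {..<n} EH (expansion_vertices r V E) (expansion_edges r E)"
    "real (((q - 1) choose (r - 1)) *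
       ((m div ((q - 2) choose (r - 2))) * m ^ (card (pairs_below q) - 1)))
       \<le> hg_spectral_radius r n EH"
proof -
  let ?N = "(q - 2) choose (r - 2)"
  obtain idx where idx: "\<And>i j. i < j \<Longrightarrow> j < q \<Longrightarrow>
      inj_on (idx (i, j)) {R. R \<subseteq> {..<q} \<and> card R = r \<and> i \<in> R \<and> j \<in> R}"
    "\<And>i j R. i < j \<Longrightarrow> j < q \<Longrightarrow> R \<subseteq> {..<q} \<Longrightarrow> card R = r \<Longrightarrow> i \<in> R \<Longrightarrow> j \<in> R \<Longrightarrow>
      idx (i, j) R < ?N"
    using ex_pair_index[of q r] by blast
  interpret partite_packing q r m "m div ?N" ?N idx
  proof
    show "1 < m" using m by simp
    show "m div ?N * ?N \<le> m" by simp
    show "0 < ?N" using r by (simp add: zero_less_binomial_iff)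
    fix d assume d: "0 < d" "d < q"
    then have "d dvd fact q" by (intro dvd_fact) auto
    then obtain c where "fact q = d * c" by blast
    then have "m = (c * l) * d + 1" using m by simp
    then have "gcd d m = gcd d 1" by (simp only: gcd_add_mult)
    then show "coprime d m" by (simp add: coprime_iff_gcd_eq_1)
  qed (use r idx in auto)
  let ?U = "{..<q} \<times> X"
  have X: "finite X" "card X = m ^ card P"
    using finite_pairs_below[of q] by (auto intro: finite_PiE simp: card_funcsetE)
  have "(\<lambda>e\<in>P. 0) \<in> X" using m by auto
  moreover have "0 \<in> {..<q}" using r by simp
  ultimately have ne: "?U \<noteq> {}" by blast
  have coordsX: "coords i p \<in> X" for i p using m by (cases p) (auto simp: coords_def)
  show thesis
  proof (rule partite_hypergraph_spectral_lower[where U = ?U and Es = "edge ` params"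
        and col = fst and q = q and n = n, OF _ ne _ r(1) _ _ _ _ _ E chrom])
    show "finite ?U" using X by simp
    show "card ?U \<le> n" using n X by (simp add: card_cartesian_product)
    show "f \<subseteq> ?U \<and> card f = r" if f: "f \<in> edge ` params" for f
    proof -
      obtain p where p: "p \<in> params" "f = edge p" using f by blast
      then have "fst p \<subseteq> {..<q}" by (auto simp: params_def blocks_def)
      then show ?thesis using card_edge[OF p(1)] coordsX unfolding p(2) edge_def by blast
    qed
    show "f = g" if fg: "f \<in> edge ` params" "g \<in> edge ` params" "{u, v} \<subseteq> f \<inter> g" "u \<noteq> v" for f g u v
    proof -
      obtain p p' where p: "p \<in> params" "f = edge p" "p' \<in> params" "g = edge p'" using fg by blast
      then show ?thesis using edges_linear[OF p(1,3), of u v] fg by simp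
    qed
    show "card {f \<in> edge ` params. u \<in> f}
        = ((q - 1) choose (r - 1)) * ((m div ?N) * m ^ (card P - 1))" if "u \<in> ?U" for u
      using that degree by (cases u) auto
    show "fst ` ?U \<subseteq> {..<q}" by auto
    show "inj_on fst f" if "f \<in> edge ` params" for f
      using that by (auto simp: edge_def inj_on_def)
  qed (rule that)
qed

text \<open>The two losses of the construction: \<open>1 / M l\<close> comes from rounding in
  \<open>m div N\<close>, and the quotient of consecutive moduli comes from an \<open>n\<close>
  between two admissible sizes.\<close>

lemma packing_ratio_tendsto:
  fixes c :: nat and A B q :: real
  assumes c: "0 < c"
  defines "M \<equiv> \<lambda>l::nat. 1 + real c * real l"
  shows "(\<lambda>l. A / q * (B - 1 / M l) * (M l / M (Suc l)) ^ D) \<longlonglongrightarrow> A / q * B"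
proof -
  have "filterlim M at_top sequentially"
    unfolding M_def
    by (intro filterlim_tendsto_add_at_top[OF tendsto_const]
        filterlim_tendsto_pos_mult_at_top[OF tendsto_const] filterlim_real_sequentially)
      (use c in simp)
  then have inv: "(\<lambda>l. 1 / M l) \<longlonglongrightarrow> 0"
    by (intro tendsto_divide_0[OF tendsto_const] filterlim_at_top_imp_at_infinity)
  have "M l / M (Suc l) = 1 - real c * (1 / M (Suc l))" for l
  proof -
    have "M (Suc l) > 0" unfolding M_def by (intro add_pos_nonneg) auto
    moreover have "M (Suc l) = M l + real c" by (simp add: M_def algebra_simps)
    ultimately show ?thesis by (simp add: field_simps)
  qed
  moreover have "(\<lambda>l. 1 - real c * (1 / M (Suc l))) \<longlonglongrightarrow> 1 - real c * 0"
    by (intro tendsto_intros LIMSEQ_Suc[OF inv])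
  ultimately have ratio: "(\<lambda>l. M l / M (Suc l)) \<longlonglongrightarrow> 1" by simp
  have "(\<lambda>l. A / q * (B - 1 / M l) * (M l / M (Suc l)) ^ D) \<longlonglongrightarrow> A / q * (B - 0) * 1 ^ D"
    by (intro tendsto_intros inv ratio)
  then show ?thesis by simp
qed

text \<open>The construction has \<open>a l\<close> vertices for sparse values only. The largest
  \<open>a l\<close> below \<open>n\<close> is used and the other vertices stay isolated; this is
  harmless since consecutive sizes have ratio tending to 1.\<close>

lemma spectral_lower:
  fixes V :: "'a set" and \<epsilon> :: real
  assumes r: "2 \<le> r" "r \<le> q" and E: "\<forall>e\<in>E. e \<subseteq> V" and chrom: "q < chromatic_number V E"
    and \<epsilon>: "\<epsilon> > 0"
  shows "\<forall>\<^sub>F n in sequentially. \<exists>EH. linear_uniform_hg r n EH \<and>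
     \<not> contains_copy {..<n} EH (expansion_vertices r V E) (expansion_edges r E) \<and>
     (1 / (real r - 1) * (1 - 1 / real q) - \<epsilon>) * real n \<le> hg_spectral_radius r n EH"
proof -
  define D where "D = card (pairs_below q)"
  define N where "N = (q - 2) choose (r - 2)"
  define C where "C = (q - 1) choose (r - 1)"
  define L where "L = 1 / (real r - 1) * (1 - 1 / real q)"
  define m where "m l = 1 + fact q * l" for l :: nat
  define a where "a l = q * m l ^ D" for l
  have "(0, 1) \<in> pairs_below q" using r by (simp add: pairs_below_def)
  then have D: "D > 0" using finite_pairs_below[of q] by (auto simp: D_def card_gt_0_iff)
  have q0: "real q > 0" using r by simp
  have N0: "N > 0" using r by (simp add: N_def zero_less_binomial_iff)
  \<comment> \<open>Absorption gives \<open>(r - 1) * C = (q - 1) * N\<close>, which turns the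
    density \<open>C / (q * N)\<close> of the construction into the target \<open>L\<close>.\<close>
  have "Suc (r - 2) * ((q - 1) choose Suc (r - 2)) = (q - 1) * ((q - 1 - 1) choose (r - 2))"
    by (rule binomial_absorption)
  moreover have "Suc (r - 2) = r - 1" "q - 1 - 1 = q - 2" using r by auto
  ultimately have "(r - 1) * C = (q - 1) * N" by (simp add: C_def N_def)
  then have "real ((r - 1) * C) = real ((q - 1) * N)" by simp
  then have CN: "(real r - 1) * real C = (real q - 1) * real N" using r by (simp add: of_nat_diff)
  have L: "real C / real q * (1 / real N) = L"
  proof -
    have "real r - 1 > 0" using r by simp
    then have "real C = (real q - 1) / (real r - 1) * real N" using CN by (simp add: field_simps)
    then have "real C / real q * (1 / real N) = (real q - 1) / (real r - 1) / real q"
      using N0 by simp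
    also have "\<dots> = 1 / (real r - 1) * ((real q - 1) / real q)" by simp
    also have "(real q - 1) / real q = 1 - 1 / real q" using q0 by (simp add: diff_divide_distrib)
    finally show ?thesis unfolding L_def .
  qed
  have mreal: "real (m l) = 1 + real (fact q) * real l" for l by (simp add: m_def)
  have m0: "real (m l) > 0" for l unfolding of_nat_0_less_iff by (simp add: m_def)
  have "(\<lambda>l. real C / real q * (1 / real N - 1 / real (m l)) * (real (m l) / real (m (Suc l))) ^ D)
      \<longlonglongrightarrow> L"
    unfolding mreal L[symmetric] by (rule packing_ratio_tendsto) simp
  then have "\<forall>\<^sub>F l in sequentially.
      L - \<epsilon> < real C / real q * (1 / real N - 1 / real (m l)) * (real (m l) / real (m (Suc l))) ^ D"
    using \<epsilon> by (intro order_tendstoD(1)) auto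
  then obtain l0 where l0: "\<And>l. l \<ge> l0 \<Longrightarrow>
      L - \<epsilon> < real C / real q * (1 / real N - 1 / real (m l)) * (real (m l) / real (m (Suc l))) ^ D"
    by (auto simp: eventually_sequentially)
  \<comment> \<open>Bounds the set of \<open>l\<close> with \<open>a l \<le> n\<close>, without
    which \<open>GREATEST\<close> below would have no meaning.\<close>
  have la: "l \<le> a l" for l
  proof -
    have "1 * l \<le> fact q * l" by (intro mult_right_mono fact_ge_1) simp
    then have "l \<le> m l" unfolding m_def by linarith
    also have "\<dots> \<le> m l ^ D" using D by (intro self_le_power) (auto simp: m_def)
    also have "\<dots> \<le> a l" using r by (simp add: a_def)
    finally show ?thesis .
  qed
  have main: "\<exists>EH. linear_uniform_hg r n EH \<and>
     \<not> contains_copy {..<n} EH (expansion_vertices r V E) (expansion_edges r E) \<and>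
     (L - \<epsilon>) * real n \<le> hg_spectral_radius r n EH" if n: "n \<ge> a (Suc l0)" for n
  proof -
    define l where "l = (GREATEST l. a l \<le> n)"
    have bnd: "y \<le> n" if "a y \<le> n" for y using la[of y] that by linarith
    note greatest = GreatestI_nat[where P = "\<lambda>l. a l \<le> n" and b = n]
      Greatest_le_nat[where P = "\<lambda>l. a l \<le> n" and b = n]
    have al: "a l \<le> n" unfolding l_def by (rule greatest(1)[OF n bnd])
    have ll0: "Suc l0 \<le> l" unfolding l_def by (rule greatest(2)[OF n bnd])
    have na: "n < a (Suc l)"
    proof (rule ccontr)
      assume "\<not> n < a (Suc l)"
      then have "a (Suc l) \<le> n" by simp
      from greatest(2)[OF this bnd] have "Suc l \<le> l" unfolding l_def .
      then show False by simp
    qed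
    define M where "M = real (m l)"
    define M' where "M' = real (m (Suc l))"
    have M: "M > 0" "M' > 0" using m0 by (auto simp: M_def M'_def)
    have lL: "L - \<epsilon> < real C / real q * (1 / real N - 1 / M) * (M / M') ^ D"
      using l0[of l] ll0 by (simp add: M_def M'_def)
    have l: "0 < l" using ll0 by simp
    obtain EH where EH: "linear_uniform_hg r n EH"
      "\<not> contains_copy {..<n} EH (expansion_vertices r V E) (expansion_edges r E)"
      "real (C * ((m l div N) * m l ^ (D - 1))) \<le> hg_spectral_radius r n EH"
      by (rule spectral_lower_modulus[OF r m_def l al[unfolded a_def D_def] E chrom,
            folded D_def C_def N_def])
    have "(L - \<epsilon>) * real n \<le> real (C * ((m l div N) * m l ^ (D - 1)))"
    \<comment> \<open>Replacing \<open>n\<close> by the larger \<open>a (Suc l)\<close> is monotone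
      only for a nonnegative factor.\<close>
    proof (cases "L - \<epsilon> \<le> 0")
      case True
      then have "(L - \<epsilon>) * real n \<le> 0" by (simp add: mult_nonpos_nonneg)
      also have "0 \<le> real (C * ((m l div N) * m l ^ (D - 1)))" by simp
      finally show ?thesis .
    next
      case False
      have "real n \<le> real (a (Suc l))" using na by simp
      then have "(L - \<epsilon>) * real n \<le> (L - \<epsilon>) * (real q * M' ^ D)"
        using False by (intro mult_left_mono) (auto simp: a_def M'_def)
      also have "\<dots> \<le> real C / real q * (1 / real N - 1 / M) * (M / M') ^ D * (real q * M' ^ D)"
        using lL M q0 by (intro mult_right_mono) auto
      also have "\<dots> = real C * (1 / real N - 1 / M) * M ^ D"
        using q0 M by (simp add: power_divide)
      also have "\<dots> = real C * ((M / real N - 1) * M ^ (D - 1))"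
      proof -
        have "M ^ D = M * M ^ (D - 1)" using D by (simp flip: power_Suc)
        then show ?thesis using M by (simp add: field_simps)
      qed
      also have "\<dots> \<le> real C * (real (m l div N) * M ^ (D - 1))"
      proof (intro mult_left_mono mult_right_mono)
        have "m l < N * Suc (m l div N)" using dividend_less_times_div[OF N0, of "m l"] by simp
        then have "M < real (N * Suc (m l div N))" unfolding M_def by (simp only: of_nat_less_iff)
        then show "M / real N - 1 \<le> real (m l div N)" using N0 by (simp add: field_simps)
      qed (use M in auto)
      finally show ?thesis by (simp add: M_def)
    qed
    then show ?thesis using EH by (intro exI[of _ EH]) auto
  qed
  show ?thesis 
    unfolding eventually_sequentially L_def[symmetric]
    by (intro exI[of _ "a (Suc l0)"] allI impI main)
qed

section \<open>The asymptotics\<close>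

text \<open>An injective colouring with \<open>card V\<close> colours is proper, so the
  \<open>LEAST\<close> is attained.\<close>

lemma chromatic_number_colouring:
  fixes V :: "'a set"
  assumes V: "finite V" and E: "\<forall>e\<in>E. e \<subseteq> V"
  obtains c :: "'a \<Rightarrow> nat" where "c ` V \<subseteq> {..<chromatic_number V E}"
    "\<forall>e\<in>E. \<forall>u\<in>e. \<forall>v\<in>e. u \<noteq> v \<longrightarrow> c u \<noteq> c v"
proof -
  let ?P = "\<lambda>k. \<exists>c::'a \<Rightarrow> nat. c ` V \<subseteq> {..<k} \<and>
      (\<forall>e\<in>E. \<forall>u\<in>e. \<forall>v\<in>e. u \<noteq> v \<longrightarrow> c u \<noteq> c v)"
  obtain h where h: "bij_betw h V {0..<card V}" using ex_bij_betw_finite_nat[OF V] by blast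
  have "?P (card V)"
  proof (intro exI[of _ h] conjI ballI impI)
    show "h ` V \<subseteq> {..<card V}" using h by (auto simp: bij_betw_def)
    fix e u v assume "e \<in> E" "u \<in> e" "v \<in> e" "u \<noteq> v"
    then have "u \<in> V" "v \<in> V" using E by auto
    then show "h u \<noteq> h v" using \<open>u \<noteq> v\<close> inj_onD[OF bij_betw_imp_inj_on[OF h]] by blast
  qed
  then have "?P (chromatic_number V E)" unfolding chromatic_number_def by (rule LeastI)
  then show thesis using that by blast
qed

theorem theorem1p6:
  fixes r k :: nat and V :: "'a set" and E :: "'a set set"
  assumes "3 \<le> r + 1" and "r + 1 \<le> k"
    and "finite V" and "\<forall>e\<in>E. e \<subseteq> V \<and> card e = 2"
    and "chromatic_number V E = k"
  shows "(\<lambda>n. spex_lin r n V E / real n) \<longlonglongrightarrow>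
           (1 / (real r - 1)) * (1 - 1 / (real k - 1))"
proof -
  define L where "L = (1 / (real r - 1)) * (1 - 1 / (real k - 1))"
  define \<H> where "\<H> n = {EH. linear_uniform_hg r n EH \<and>
    \<not> contains_copy {..<n} EH (expansion_vertices r V E) (expansion_edges r E)}" for n
  have spex: "spex_lin r n V E = Sup (hg_spectral_radius r n ` \<H> n)" for n
    by (simp add: spex_lin_def \<H>_def)
  have r: "2 \<le> r" "r \<le> k - 1" and k: "2 \<le> k" "k - 1 < chromatic_number V E"
    and kreal: "real (k - 1) = real k - 1"
    using assms(1,2,5) by auto
  have EV: "\<forall>e\<in>E. e \<subseteq> V" using assms(4) by blast
  obtain c :: "'a \<Rightarrow> nat" where c: "c ` V \<subseteq> {..<k}"
    "\<forall>e\<in>E. \<forall>u\<in>e. \<forall>v\<in>e. u \<noteq> v \<longrightarrow> c u \<noteq> c v"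
    using chromatic_number_colouring[OF assms(3) EV] assms(5) by metis
  \<comment> \<open>There are finitely many hypergraphs on \<open>n\<close> vertices, so each
    spectral radius lies below the supremum, whatever value it takes.\<close>
  have bdd: "bdd_above (hg_spectral_radius r n ` \<H> n)" for n
  proof -
    have "finite (\<H> n)"
      by (rule finite_subset[of _ "Pow (Pow {..<n})"]) (auto simp: \<H>_def linear_uniform_hg_def)
    then show ?thesis by (intro bdd_above_finite finite_imageI)
  qed
  have lower: "\<forall>\<^sub>F n in sequentially. \<exists>EH\<in>\<H> n. (L - \<epsilon>) * real n \<le> hg_spectral_radius r n EH"
    if "\<epsilon> > 0" for \<epsilon>
    using spectral_lower[OF r EV k(2) that] unfolding kreal
    by (rule eventually_mono) (auto simp: \<H>_def L_def)
  have pos: "\<forall>\<^sub>F n in sequentially. real n > 0"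
    using eventually_gt_at_top[of 0] by (rule eventually_mono) simp
  have "(\<lambda>n. spex_lin r n V E / real n) \<longlonglongrightarrow> L"
  proof (rule order_tendstoI)
    fix a assume a: "a < L"
    define \<epsilon> where "\<epsilon> = (L - a) / 2"
    have \<epsilon>: "\<epsilon> > 0" "a < L - \<epsilon>" using a by (simp_all add: \<epsilon>_def field_simps)
    show "\<forall>\<^sub>F n in sequentially. a < spex_lin r n V E / real n"
      using lower[OF \<epsilon>(1)] pos
    proof eventually_elim
      case (elim n)
      then obtain EH where EH: "EH \<in> \<H> n" "(L - \<epsilon>) * real n \<le> hg_spectral_radius r n EH" by blast
      have "hg_spectral_radius r n EH \<le> spex_lin r n V E"
        unfolding spex by (intro cSup_upper imageI EH bdd)
      then have "(L - \<epsilon>) * real n \<le> spex_lin r n V E" using EH by linarith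
      then have "L - \<epsilon> \<le> spex_lin r n V E / real n" using elim by (simp add: pos_le_divide_eq)
      then show ?case using \<epsilon> by linarith
    qed
  next
    fix a assume a: "L < a"
    define \<epsilon> where "\<epsilon> = (a - L) / 2"
    have \<epsilon>: "\<epsilon> > 0" "L + \<epsilon> < a" using a by (simp_all add: \<epsilon>_def field_simps)
    have "1 / (real k - 1) \<le> 1" using k by (simp add: field_simps)
    then have "L \<ge> 0" using r unfolding L_def by (intro mult_nonneg_nonneg) auto
    then have L\<epsilon>: "L + \<epsilon> > 0" using \<epsilon> by linarith
    \<comment> \<open>The junk value of the spectral radius in case there is no eigenvalue is a constant,
      so it is eventually below the bound.\<close>
    have "filterlim (\<lambda>n. (L + \<epsilon>) * real n) at_top sequentially"
      by (intro filterlim_tendsto_pos_mult_at_top[OF tendsto_const L\<epsilon>] filterlim_real_sequentially)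
    then have junk: "\<forall>\<^sub>F n in sequentially. Sup {} \<le> (L + \<epsilon>) * real n"
      by (simp add: filterlim_at_top)
    show "\<forall>\<^sub>F n in sequentially. spex_lin r n V E / real n < a"
      using hg_eigenvalue_upper[OF r(1) k(1) assms(3,4) c \<epsilon>(1)] lower[OF \<epsilon>(1)] pos junk
    proof eventually_elim
      case (elim n)
      have "spex_lin r n V E \<le> (L + \<epsilon>) * real n"
        unfolding spex
      proof (rule cSup_least)
        \<comment> \<open>The lower bound serves here only to provide an admissible
          hypergraph.\<close>
        show "hg_spectral_radius r n ` \<H> n \<noteq> {}" using elim(2) by blast
        fix \<rho> assume "\<rho> \<in> hg_spectral_radius r n ` \<H> n"
        then obtain EH where EH: "EH \<in> \<H> n" "\<rho> = hg_spectral_radius r n EH" by blast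
        have bound: "cmod lam \<le> (L + \<epsilon>) * real n" if "hg_eigenvalue r n EH lam" for lam
          using elim(1) EH(1) that unfolding \<H>_def L_def by blast
        show "\<rho> \<le> (L + \<epsilon>) * real n"
        proof (cases "{lam. hg_eigenvalue r n EH lam} = {}")
          case True
          then show ?thesis using elim(4) EH(2) by (simp add: hg_spectral_radius_def)
        next
          case False
          then show ?thesis
            unfolding EH(2) hg_spectral_radius_def using bound by (intro cSup_least) auto
        qed
      qed
      then have "spex_lin r n V E / real n \<le> L + \<epsilon>" using elim(3) by (simp add: pos_divide_le_eq)
      then show ?case using \<epsilon> by linarith
    qed
  qed
  then show ?thesis by (simp only: L_def)
qed

end
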